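(* Let $m\ge 2$ be an integer and let $\{x_i\}$ be a non-decreasing sequence of real knots. Let $j$ be an index with $0<x_{j+m}-x_j<\frac{2\pi h}{\ln(1+h)}$. Then the $h$-derivative (with respect to $x$) of the $h$-trigonometric B-spline $T_{j,m}(x;h)$ is $$\Delta_hT_{j,m}(x;h)=i\,e_h^{\frac{i}{4}(m-1)h}\,\frac{e_h^{-i(m-1)h/2}-1}{h\sin_h\left(\frac{x_{j+m}-x_j}{2}\right)}\left\{\cos_h\left(\frac{x-(m-3)h/2-x_j}{2}\right)T_{j,m-1}(x;h)-\cos_h\left(\frac{x_{j+m}-x+(m-3)h/2}{2}\right)T_{j+1,m-1}(x;h)\right\}.$$
   Context: Fix a real number $h\neq 0$, $h>-1$. For real $x$ put $e_h^{ix}=(1+h)^{ix/h}=\exp\left(ix\frac{\ln(1+h)}{h}\right)$, $\cos_h x=\frac{e_h^{ix}+e_h^{-ix}}{2}$, $\sin_h x=\frac{e_h^{ix}-e_h^{-ix}}{2i}$. The $h$-derivative is $\Delta_hf(x)=\frac{f(x+h)-f(x)}{h}$. For functions $\varphi_0,\dots,\varphi_m$ and points $x_0,\dots,x_m$, $\det\begin{pmatrix}\varphi_0&\cdots&\varphi_m\\ x_0&\cdots&x_m\end{pmatrix}$ denotes the determinant of the matrix whose row $r$ is $(\varphi_0(x_r),\dots,\varphi_m(x_r))$, $r=0,\dots,m$. $h$-trigonometric divided difference: for $m\ge1$, $x_0<\cdots<x_m$ with $x_m-x_0<\frac{2\pi h}{\ln(1+h)}$ and a function $f$ defined at the nodes,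 $$[x_0,\ldots,x_m;h]_t f=2^{m-1}\frac{\det\begin{pmatrix}1&\cos_h x&\sin_h x&\cdots&\cos_h nx&\sin_h nx&f(x)\\ x_0&x_1&x_2&\cdots&x_{m-2}&x_{m-1}&x_m\end{pmatrix}}{\det\begin{pmatrix}\cos_h\frac x2&\sin_h\frac x2&\cdots&\cos_h(n+\frac12)x&\sin_h(n+\frac12)x\\ x_0&x_1&\cdots&x_{m-1}&x_m\end{pmatrix}}\quad\text{if } m=2n+1,$$ $$[x_0,\ldots,x_m;h]_t f=2^{m}\frac{\det\begin{pmatrix}\cos_h\frac x2&\sin_h\frac x2&\cdots&\cos_h(n-\frac12)x&\sin_h(n-\frac12)x&f(x)\\ x_0&x_1&\cdots&x_{m-2}&x_{m-1}&x_m\end{pmatrix}}{\det\begin{pmatrix}1&\cos_h x&\sin_h x&\cdots&\cos_h nx&\sin_h nx\\ x_0&x_1&x_2&\cdots&x_{m-1}&x_m\end{pmatrix}}\quad\text{if } m=2n.$$ If some (not all) of the nodes coincide, the divided difference is read as the limit of its values at distinct nodes that approach the given ones from the left. $h$-truncated power: for $m\ge 1$, $\left(\sin_h\frac{y-x}{2}\right)_+^{m-1}=\prod_{l=0}^{m-2}\sin_h\left(\frac{y-(x-lh)}{2}\right)$ if $y>x$, and $0$ if $y\le x$ (the empty product, for $m=1$, is $1$). $h$-trigonometric B-splines: for $m\ge1$, $T_{j,m}(x;h)\equiv0$ if $x_{j+m}=x_j$, and if $x_{j+m}>x_j$, $T_{j,m}(x;h)=[x_j,\ldots,x_{j+m};h]_t\left(\sin_h\frac{y-x}{2}\right)_+^{m-1}$,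 the divided difference being taken with respect to $y$. In particular, if $x_{j+1}>x_j$, $T_{j,1}(x;h)=1/\sin_h\left(\frac{x_{j+1}-x_j}{2}\right)$ if $x_j\le x<x_{j+1}$ and $0$ otherwise.
   Formalization: As stated the formula fails when a knot separates x and x+h; it is proved literally when x and x+h lie in the same knot interval, and for every x with T_{j,m} replaced by the entire continuation of its piece on the knot interval containing x. *)

theory Defs
  imports "HOL-Complex_Analysis.Complex_Analysis" "Jordan_Normal_Form.Determinant"
begin

text \<open>\<open>hcis h x\<close> is \<open>e\<^sub>h\<^sup>i\<^sup>x = (1 + h)\<^sup>i\<^sup>x\<^sup>/\<^sup>h\<close>.\<close>

definition hcis :: "real \<Rightarrow> real \<Rightarrow> complex" where
  "hcis h x = exp (\<i> * of_real x * of_real (ln (1 + h) / h))"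

definition hcos :: "real \<Rightarrow> real \<Rightarrow> complex" where
  "hcos h x = (hcis h x + hcis h (- x)) / 2"

definition hsin :: "real \<Rightarrow> real \<Rightarrow> complex" where
  "hsin h x = (hcis h x - hcis h (- x)) / (2 * \<i>)"

definition hdiff :: "real \<Rightarrow> (real \<Rightarrow> complex) \<Rightarrow> real \<Rightarrow> complex" where
  "hdiff h f x = (f (x + h) - f x) / of_real h"

definition colloc_det :: "nat \<Rightarrow> (nat \<Rightarrow> real \<Rightarrow> complex) \<Rightarrow> (nat \<Rightarrow> real) \<Rightarrow> complex" where
  "colloc_det m \<phi> x =
     Determinant.det (Matrix.mat (m + 1) (m + 1) (\<lambda>(r, c). \<phi> c (x r)))"

text \<open>The two systems \<open>1, cos\<^sub>h x, sin\<^sub>h x, cos\<^sub>h 2x, sin\<^sub>h 2x, \<dots>\<close> and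
  \<open>cos\<^sub>h (x/2), sin\<^sub>h (x/2), cos\<^sub>h (3x/2), sin\<^sub>h (3x/2), \<dots>\<close>, enumerated from index 0.\<close>

definition int_system :: "real \<Rightarrow> nat \<Rightarrow> real \<Rightarrow> complex" where
  "int_system h c x =
     (if c = 0 then 1
      else if odd c then hcos h (real ((c + 1) div 2) * x)
      else hsin h (real (c div 2) * x))"

definition half_system :: "real \<Rightarrow> nat \<Rightarrow> real \<Rightarrow> complex" where
  "half_system h c x =
     (if even c then hcos h ((real (c div 2) + 1/2) * x)
      else hsin h ((real (c div 2) + 1/2) * x))"

definition trig_dd_distinct ::
    "real \<Rightarrow> nat \<Rightarrow> (nat \<Rightarrow> real) \<Rightarrow> (real \<Rightarrow> complex) \<Rightarrow> complex" where
  "trig_dd_distinct h m x f =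
     (if odd m
      then 2 ^ (m - 1) * colloc_det m ((int_system h)(m := f)) x / colloc_det m (half_system h) x
      else 2 ^ m * colloc_det m ((half_system h)(m := f)) x / colloc_det m (int_system h) x)"

text \<open>The node vectors \<open>y\<^sub>0 < \<dots> < y\<^sub>m\<close> with \<open>y\<^sub>i\<close> tending to \<open>x\<^sub>i\<close> from the left for all \<open>i \<le> m\<close>.
  Only the values at indices \<open>0, \<dots>, m\<close> matter.\<close>

definition nodes_at_left :: "nat \<Rightarrow> (nat \<Rightarrow> real) \<Rightarrow> (nat \<Rightarrow> real) filter" where
  "nodes_at_left m x =
     inf (INF i\<in>{..m}. filtercomap (\<lambda>y. y i) (at_left (x i)))
         (principal {y. strict_mono_on {..m} y})"

definition trig_dd ::
    "real \<Rightarrow> nat \<Rightarrow> (nat \<Rightarrow> real) \<Rightarrow> (real \<Rightarrow> complex) \<Rightarrow> complex" where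
  "trig_dd h m x f =
     (if strict_mono_on {..m} x then trig_dd_distinct h m x f
      else Lim (nodes_at_left m x) (\<lambda>y. trig_dd_distinct h m y f))"

text \<open>\<open>htrunc h n x y\<close> is the truncated power of exponent \<open>n\<close> of \<open>sin\<^sub>h ((y - x)/2)\<close>.\<close>

definition htrunc :: "real \<Rightarrow> nat \<Rightarrow> real \<Rightarrow> real \<Rightarrow> complex" where
  "htrunc h n x y =
     (if y > x then \<Prod>l<n. hsin h ((y - (x - real l * h)) / 2) else 0)"

definition trig_bspline :: "real \<Rightarrow> (nat \<Rightarrow> real) \<Rightarrow> nat \<Rightarrow> nat \<Rightarrow> real \<Rightarrow> complex" where
  "trig_bspline h \<xi> j m x =
     (if \<xi> (j + m) = \<xi> j then 0
      else trig_dd h m (\<lambda>i. \<xi> (j + i)) (\<lambda>y. htrunc h (m - 1) x y))"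

text \<open>The points lying in the same one of the intervals \<open>(-\<infinity>, a\<^sub>0), [a\<^sub>0, a\<^sub>1), \<dots>, [a\<^sub>k, \<infinity>)\<close>
  as \<open>x\<close>, where \<open>a\<^sub>0 < \<dots> < a\<^sub>k\<close> are the distinct values among \<open>\<xi>\<^sub>j, \<dots>, \<xi>\<^sub>j\<^sub>+\<^sub>m\<close>.  On each of these
  intervals the B-spline is the restriction of a single \<open>h\<close>-trigonometric polynomial.

  The shift \<open>x + h\<close> may leave the interval of \<open>x\<close>.  The formula for the \<open>h\<close>-derivative concerns
  the trigonometric polynomial pieces: if a knot separates \<open>x\<close> and \<open>x + h\<close>, it fails in general
  for the difference quotient of the glued function.  For example, let \<open>h > 0\<close>, \<open>m = 2\<close>, with
  distinct knots, and take \<open>x\<close> slightly below \<open>\<xi>\<^sub>j\<close>: then both B-splines of lower order vanish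
  at \<open>x\<close>, and so does \<open>T\<^sub>j\<^sub>,\<^sub>2\<close>, but \<open>T\<^sub>j\<^sub>,\<^sub>2\<close> does not vanish at \<open>x + h\<close> if \<open>x + h\<close> lies just above
  \<open>\<xi>\<^sub>j\<close>.\<close>

definition knot_cell :: "(nat \<Rightarrow> real) \<Rightarrow> nat \<Rightarrow> nat \<Rightarrow> real \<Rightarrow> real set" where
  "knot_cell \<xi> j m x = {t. \<forall>i\<in>{j..j + m}. t < \<xi> i \<longleftrightarrow> x < \<xi> i}"

end

theory Submission
  imports Defs
begin

text \<open>Put \<open>\<kappa> = ln (1 + h) / (2 h) > 0\<close> and replace every node \<open>y\<^sub>k\<close> by \<open>v\<^sub>k = \<kappa> y\<^sub>k\<close>.  Then
  \<open>sin\<^sub>h ((y\<^sub>k - y\<^sub>i)/2) = sin (v\<^sub>k - v\<^sub>i)\<close>, the condition on the span of the nodes says that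
  \<open>v\<^sub>m - v\<^sub>0 < \<pi>\<close>, and both trigonometric systems consist of the functions \<open>cos (e v)\<close>, \<open>sin (e v)\<close>
  with integers \<open>e\<close> of one fixed parity.

  For distinct nodes the quotient of determinants is the weighted sum
  \[ [x_0,\ldots,x_m;h]_t f = \sum_k \frac{f(x_k)}{\prod_{i \ne k} \sin (v_k - v_i)} \]
  (\<open>trig_dd_distinct_eq_sine_dd\<close>), because the right-hand side annihilates the trigonometric
  functions of the numerator.  The sum satisfies the two-term recurrence \<open>sine_dd_recurrence\<close>: if
  \<open>g(v) = a cos v + b sin v\<close>, then
  \[ \sin (v_m - v_0)\, [x_0,\ldots,x_m] (g f) = g(v_m) [x_1,\ldots,x_m] f - g(v_0) [x_0,\ldots,x_{m-1}] f . \]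
  This recurrence does all the work.  The truncated powers of consecutive orders differ by
  one sine factor, so taking that factor for \<open>g\<close> gives the recursion of the B-splines in their order.  The step
  \<open>x \<mapsto> x + h\<close> replaces one sine factor of the truncated power by another one, and
  the difference of these two is a constant times a cosine; taking that cosine for \<open>g\<close> gives the
  formula for the \<open>h\<close>-derivative (\<open>spline_piece_difference_separated\<close>).

  For coincident knots a limit has to be taken.  The recursion in the order, with the information on
  which knots lie to the right of \<open>x\<close> frozen, defines a function \<open>spline_piece\<close> of the knots and of \<open>x\<close>
  which makes sense for arbitrary knots: a quotient by \<open>sin 0\<close> is \<open>0\<close> and occurs only where the
  spline vanishes anyway.  It is continuous at every admissible knot vector, along all knot vectors tending to it
  (\<open>tendsto_spline_piece\<close>), hence equals the B-spline (\<open>trig_bspline_eq_spline_piece\<close>), it inherits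
  the difference formula from distinct knots (\<open>spline_piece_difference\<close>), and it is entire in
  \<open>x\<close>, so it is the required holomorphic continuation of the B-spline from a knot cell.\<close>

section \<open>Divided differences as weighted sums\<close>

definition sin_separated :: "(nat \<Rightarrow> complex) \<Rightarrow> nat set \<Rightarrow> bool" where
  "sin_separated v A \<longleftrightarrow> (\<forall>i\<in>A. \<forall>k\<in>A. i \<noteq> k \<longrightarrow> sin (v k - v i) \<noteq> 0)"

text \<open>The value \<open>0\<close> outside \<open>{j..j + m}\<close> makes it possible to compare the weights for two node
  ranges inside one sum over a larger range.\<close>

definition sine_weight :: "(nat \<Rightarrow> complex) \<Rightarrow> nat \<Rightarrow> nat \<Rightarrow> nat \<Rightarrow> complex" where
  "sine_weight v j m k =
     (if k \<in> {j..j + m} then 1 / (\<Prod>i\<in>{j..j + m} - {k}. sin (v k - v i)) else 0)"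

definition sine_dd :: "(nat \<Rightarrow> complex) \<Rightarrow> nat \<Rightarrow> nat \<Rightarrow> (nat \<Rightarrow> complex) \<Rightarrow> complex" where
  "sine_dd v j m f = (\<Sum>k\<in>{j..j + m}. sine_weight v j m k * f k)"

lemma sin_separated_subset: "sin_separated v A \<Longrightarrow> B \<subseteq> A \<Longrightarrow> sin_separated v B"
  by (auto simp: sin_separated_def)

lemma sine_dd_cong:
  "(\<And>k. k \<in> {j..j + m} \<Longrightarrow> f k = g k) \<Longrightarrow> sine_dd v j m f = sine_dd v j m g"
  by (simp add: sine_dd_def)

lemma sine_dd_cmult: "sine_dd v j m (\<lambda>k. c * f k) = c * sine_dd v j m f"
  by (simp add: sine_dd_def sum_distrib_left mult_ac)

lemma sine_dd_add: "sine_dd v j m (\<lambda>k. f k + g k) = sine_dd v j m f + sine_dd v j m g"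
  by (simp add: sine_dd_def sum.distrib algebra_simps)

lemma sine_dd_diff: "sine_dd v j m (\<lambda>k. f k - g k) = sine_dd v j m f - sine_dd v j m g"
  by (simp add: sine_dd_def sum_subtractf algebra_simps)

lemma sine_dd_0: "sine_dd v j 0 f = f j"
  by (simp add: sine_dd_def sine_weight_def)

text \<open>At the removed node both sides vanish: on the left because of the sine, on the right
  by the convention for weights outside their range.\<close>

lemma sine_weight_drop_first:
  assumes "sin_separated v {j..j + Suc m}" "k \<in> {j..j + Suc m}"
  shows "sin (v k - v j) * sine_weight v j (Suc m) k = sine_weight v (Suc j) m k"
proof (cases "k = j")
  case True
  then show ?thesis by (simp add: sine_weight_def)
next
  case False
  have "{j..j + Suc m} - {k} = insert j ({Suc j..Suc j + m} - {k})"
    using False by auto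
  moreover have "sin (v k - v j) \<noteq> 0"
    using assms False by (auto simp: sin_separated_def)
  ultimately show ?thesis
    using assms(2) False by (auto simp: sine_weight_def)
qed

lemma sine_weight_drop_last:
  assumes "sin_separated v {j..j + Suc m}" "k \<in> {j..j + Suc m}"
  shows "sin (v (j + Suc m) - v k) * sine_weight v j (Suc m) k = - sine_weight v j m k"
proof (cases "k = j + Suc m")
  case True
  then show ?thesis by (simp add: sine_weight_def)
next
  case False
  have eq: "{j..j + Suc m} - {k} = insert (j + Suc m) ({j..j + m} - {k})"
    using False by auto
  have "sin (v (j + Suc m) - v k) \<noteq> 0"
    using assms False by (auto simp: sin_separated_def)
  moreover have "sin (v k - v (j + Suc m)) = - sin (v (j + Suc m) - v k)"
    by (metis minus_diff_eq sin_minus)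
  ultimately show ?thesis
    using assms(2) False unfolding sine_weight_def eq by (auto simp: field_simps)
qed

text \<open>The hypothesis on \<open>g\<close> holds for the values of a linear combination of \<open>cos\<close> and \<open>sin\<close> at the
  nodes; it interpolates \<open>g\<close> between the first and the last node.  The two sine factors on its
  right-hand side cancel a factor in the weights, which removes the first or the last node.\<close>

lemma sine_dd_recurrence:
  assumes sep: "sin_separated v {j..j + Suc m}"
    and g: "\<And>k. k \<in> {j..j + Suc m} \<Longrightarrow>
              sin (v (j + Suc m) - v j) * g k
                = sin (v k - v j) * g (j + Suc m) + sin (v (j + Suc m) - v k) * g j"
  shows "sin (v (j + Suc m) - v j) * sine_dd v j (Suc m) (\<lambda>k. g k * f k)
           = g (j + Suc m) * sine_dd v (Suc j) m f - g j * sine_dd v j m f"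
proof -
  let ?I = "{j..j + Suc m}" and ?S = "sin (v (j + Suc m) - v j)"
  have "?S * sine_dd v j (Suc m) (\<lambda>k. g k * f k)
      = (\<Sum>k\<in>?I. (?S * g k) * sine_weight v j (Suc m) k * f k)"
    by (simp only: sine_dd_def sum_distrib_left mult_ac)
  also have "\<dots> = (\<Sum>k\<in>?I. g (j + Suc m) * (sine_weight v (Suc j) m k * f k)
                          - g j * (sine_weight v j m k * f k))"
  proof (rule sum.cong[OF refl])
    fix k assume k: "k \<in> ?I"
    have "(?S * g k) * sine_weight v j (Suc m) k * f k
        = (g (j + Suc m) * (sin (v k - v j) * sine_weight v j (Suc m) k)
           + g j * (sin (v (j + Suc m) - v k) * sine_weight v j (Suc m) k)) * f k"
      unfolding g[OF k] by (simp only: algebra_simps)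
    also have "\<dots> = g (j + Suc m) * (sine_weight v (Suc j) m k * f k)
                      - g j * (sine_weight v j m k * f k)"
      unfolding sine_weight_drop_first[OF sep k] sine_weight_drop_last[OF sep k]
      by (simp add: algebra_simps)
    finally show "(?S * g k) * sine_weight v j (Suc m) k * f k
        = g (j + Suc m) * (sine_weight v (Suc j) m k * f k)
                      - g j * (sine_weight v j m k * f k)" .
  qed
  also have "\<dots> = g (j + Suc m) * (\<Sum>k\<in>?I. sine_weight v (Suc j) m k * f k)
                  - g j * (\<Sum>k\<in>?I. sine_weight v j m k * f k)"
    by (simp only: sum_subtractf sum_distrib_left)
  also have "(\<Sum>k\<in>?I. sine_weight v (Suc j) m k * f k) = sine_dd v (Suc j) m f"
    unfolding sine_dd_def by (rule sum.mono_neutral_right) (auto simp: sine_weight_def)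
  also have "(\<Sum>k\<in>?I. sine_weight v j m k * f k) = sine_dd v j m f"
    unfolding sine_dd_def by (rule sum.mono_neutral_right) (auto simp: sine_weight_def)
  finally show ?thesis .
qed

lemma sin_interpolation_sin:
  fixes a b t u :: complex
  shows "sin (b - a) * sin (u - t) = sin (u - a) * sin (b - t) + sin (b - u) * sin (a - t)"
  by (simp add: sin_diff cos_diff algebra_simps)

lemma sin_interpolation_cos:
  fixes a b t u :: complex
  shows "sin (b - a) * cos (u - t) = sin (u - a) * cos (b - t) + sin (b - u) * cos (a - t)"
  by (simp add: sin_diff cos_diff algebra_simps)

text \<open>The identities for \<open>exp (\<i> v)\<close> and for \<open>exp (- \<i> v)\<close> are the same computation; \<open>\<omega>\<close> stands for
  either of the two imaginary units.\<close>

lemma exp_unit_Euler: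
  fixes \<omega> z :: complex
  assumes "\<omega>\<^sup>2 = - 1"
  shows "exp (\<omega> * z) = cos z + \<omega> * sin z"
proof -
  have "\<omega> = \<i> \<or> \<omega> = - \<i>"
    using assms by (metis i_squared power2_eq_iff power2_i)
  then show ?thesis
    by (auto simp: exp_Euler exp_minus_Euler)
qed

lemma sin_interpolation_exp:
  fixes a b u \<omega> :: complex
  assumes "\<omega>\<^sup>2 = - 1"
  shows "sin (b - a) * exp (\<omega> * u) = sin (u - a) * exp (\<omega> * b) + sin (b - u) * exp (\<omega> * a)"
  unfolding exp_unit_Euler[OF assms]
  using sin_interpolation_sin[of b a u 0] sin_interpolation_cos[of b a u 0]
  by (simp add: algebra_simps) algebra

text \<open>Induction on the order: one factor \<open>exp (\<plusminus> \<i> v)\<close> is split off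
  as the function \<open>g\<close> of the recurrence, and the remaining exponent is admissible for the smaller order.\<close>

lemma sine_dd_exp_eq_0:
  fixes e :: int
  assumes "sin_separated v {j..j + Suc n}" "\<bar>e\<bar> \<le> int n" "even (e + int n)"
  shows "sine_dd v j (Suc n) (\<lambda>k. exp (\<i> * of_int e * v k)) = 0"
  using assms
proof (induction n arbitrary: j e)
  case 0
  have "sine_weight v j (Suc 0) j + sine_weight v j (Suc 0) (Suc j) = 0"
  proof -
    have "{j..Suc j} - {j} = {Suc j}" "{j..Suc j} - {Suc j} = {j}" by auto
    then show ?thesis
      using sin_minus[of "v (Suc j) - v j"] by (simp add: sine_weight_def)
  qed
  then show ?case
    using 0 by (simp add: sine_dd_def)
next
  case (Suc n)
  \<comment> \<open>the exponent is moved one step towards \<open>0\<close>, and from \<open>0\<close> to \<open>1\<close>\<close>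
  have "\<exists>s\<in>{1, -1}. \<bar>e - s\<bar> \<le> int n \<and> even (e - s + int n)"
  proof (cases "e > 0")
    case True then show ?thesis using Suc.prems by auto
  next
    case False
    then have "e = 0 \<longrightarrow> n > 0" using Suc.prems by (cases n) auto
    then show ?thesis using False Suc.prems by auto
  qed
  then obtain s where s: "s \<in> {1, - 1}" "\<bar>e - s\<bar> \<le> int n" "even (e - s + int n)"
    by blast
  let ?b = "j + Suc (Suc n)"
  let ?\<omega> = "\<i> * of_int s"
  have \<omega>: "?\<omega>\<^sup>2 = - 1" using s(1) by (auto simp: power_mult_distrib)
  have "sin (v ?b - v j) * sine_dd v j (Suc (Suc n))
          (\<lambda>k. exp (?\<omega> * v k) * exp (\<i> * of_int (e - s) * v k))
      = exp (?\<omega> * v ?b) * sine_dd v (Suc j) (Suc n) (\<lambda>k. exp (\<i> * of_int (e - s) * v k))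
        - exp (?\<omega> * v j) * sine_dd v j (Suc n) (\<lambda>k. exp (\<i> * of_int (e - s) * v k))"
    by (rule sine_dd_recurrence[OF Suc.prems(1)]) (rule sin_interpolation_exp[OF \<omega>])
  also have "\<dots> = 0"
    using Suc.IH[of "Suc j" "e - s"] Suc.IH[of j "e - s"] s(2,3)
      sin_separated_subset[OF Suc.prems(1)] by auto
  also have "(\<lambda>k. exp (?\<omega> * v k) * exp (\<i> * of_int (e - s) * v k))
      = (\<lambda>k. exp (\<i> * of_int e * v k))"
    by (simp flip: exp_add add: algebra_simps)
  finally show ?case
    using Suc.prems(1) by (auto simp: sin_separated_def)
qed

text \<open>The first exponents beyond the annihilated range.  The value is never zero, which is what the
  evaluation of the determinants below relies on.\<close>

lemma sine_dd_exp_top: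
  fixes \<omega> :: complex
  assumes "sin_separated v {j..j + n}" and \<omega>: "\<omega>\<^sup>2 = - 1"
  shows "sine_dd v j n (\<lambda>k. exp (\<omega> * of_nat (Suc n) * v k))
           = (2 * \<omega>) ^ n * exp (\<omega> * (\<Sum>k\<in>{j..j + n}. v k))"
  using assms(1)
proof (induction n arbitrary: j)
  case 0
  then show ?case by (simp add: sine_dd_0)
next
  case (Suc n)
  let ?b = "j + Suc n"
  let ?f = "\<lambda>k. exp (\<omega> * of_nat (Suc n) * v k)"
  define M where "M = (\<Sum>k\<in>{Suc j..j + n}. v k)"
  have sums: "(\<Sum>k\<in>{Suc j..Suc j + n}. v k) = M + v ?b" "(\<Sum>k\<in>{j..j + n}. v k) = v j + M"
    "(\<Sum>k\<in>{j..j + Suc n}. v k) = v j + M + v ?b"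
    by (simp_all add: M_def sum.atLeast_Suc_atMost)
  have nz: "sin (v ?b - v j) \<noteq> 0"
    using Suc.prems by (auto simp: sin_separated_def)
  have "sin (v ?b - v j) * sine_dd v j (Suc n) (\<lambda>k. exp (\<omega> * v k) * ?f k)
      = exp (\<omega> * v ?b) * sine_dd v (Suc j) n ?f - exp (\<omega> * v j) * sine_dd v j n ?f"
    by (rule sine_dd_recurrence[OF Suc.prems]) (rule sin_interpolation_exp[OF \<omega>])
  also have "\<dots> = (2 * \<omega>) ^ n * exp (\<omega> * M) * (exp (\<omega> * v ?b)^2 - exp (\<omega> * v j)^2)"
    using Suc.IH[of "Suc j"] Suc.IH[of j] sin_separated_subset[OF Suc.prems]
    by (simp add: sums[simplified] exp_add ring_distribs power2_eq_square)
  also have "exp (\<omega> * v ?b)^2 - exp (\<omega> * v j)^2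
      = 2 * \<omega> * sin (v ?b - v j) * (exp (\<omega> * v ?b) * exp (\<omega> * v j))"
  proof -
    have "exp (\<omega> * (v ?b - v j)) - exp (\<omega> * (v j - v ?b)) = 2 * \<omega> * sin (v ?b - v j)"
      unfolding exp_unit_Euler[OF \<omega>] by (simp add: sin_diff cos_diff algebra_simps)
    then have "(exp (\<omega> * (v ?b - v j)) - exp (\<omega> * (v j - v ?b)))
          * (exp (\<omega> * v ?b) * exp (\<omega> * v j))
        = 2 * \<omega> * sin (v ?b - v j) * (exp (\<omega> * v ?b) * exp (\<omega> * v j))"
      by simp
    then show ?thesis
      by (simp add: algebra_simps power2_eq_square flip: exp_add)
  qed
  also have "(2 * \<omega>) ^ n * exp (\<omega> * M)
        * (2 * \<omega> * sin (v ?b - v j) * (exp (\<omega> * v ?b) * exp (\<omega> * v j)))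
      = sin (v ?b - v j) * ((2 * \<omega>) ^ Suc n * exp (\<omega> * (v j + M + v ?b)))"
    by (simp add: exp_add ring_distribs)
  also have "(\<lambda>k. exp (\<omega> * v k) * ?f k) = (\<lambda>k. exp (\<omega> * of_nat (Suc (Suc n)) * v k))"
    by (simp flip: exp_add add: algebra_simps)
  finally show ?case
    using nz by (simp only: sums mult_cancel_left) simp
qed

section \<open>Determinants of the trigonometric systems\<close>

definition val_det :: "nat \<Rightarrow> (nat \<Rightarrow> nat \<Rightarrow> complex) \<Rightarrow> complex" where
  "val_det n G = Determinant.det (Matrix.mat n n (\<lambda>(r, c). G c r))"

lemma val_det_cong:
  assumes "\<And>c r. c < n \<Longrightarrow> r < n \<Longrightarrow> G c r = H c r"
  shows "val_det n G = val_det n H"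
proof -
  have "Matrix.mat n n (\<lambda>(r, c). G c r) = Matrix.mat n n (\<lambda>(r, c). H c r)"
    using assms by (intro eq_matI) auto
  then show ?thesis by (simp add: val_det_def)
qed

text \<open>Row elimination: replacing the last row by the combination of all rows with coefficients \<open>u\<close>
  multiplies the determinant by \<open>u n\<close> and leaves only the last entry of that row.\<close>

lemma val_det_eliminate_last_row:
  assumes zero: "\<And>c. c < n \<Longrightarrow> (\<Sum>k\<le>n. u k * G c k) = 0"
  shows "u n * val_det (Suc n) G = (\<Sum>k\<le>n. u k * G n k) * val_det n G"
proof -
  let ?N = "Suc n"
  define A where "A = Matrix.mat ?N ?N (\<lambda>(r, c). G c r)"
  define W where "W = Matrix.mat ?N ?N (\<lambda>(r, c). if r = n then u c else of_bool (r = c))"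
  define B where "B = Matrix.mat ?N ?N
    (\<lambda>(r, c). if r = n then (if c = n then \<Sum>k\<le>n. u k * G n k else 0) else G c r)"
  have car: "A \<in> carrier_mat ?N ?N" "W \<in> carrier_mat ?N ?N" "B \<in> carrier_mat ?N ?N"
    by (auto simp: A_def W_def B_def)
  \<comment> \<open>\<open>W\<close> performs the row operation; it is lower triangular with diagonal \<open>1, \<dots>, 1, u n\<close>\<close>
  have "W * A = B"
  proof (rule eq_matI)
    fix r c assume "r < dim_row B" "c < dim_col B"
    then have rc: "r \<le> n" "c \<le> n" by (auto simp: B_def)
    have "(W * A) $$ (r, c) = (\<Sum>k\<in>{0..<?N}. W $$ (r, k) * A $$ (k, c))"
      using rc car by (simp add: scalar_prod_def)
    also have "\<dots> = (\<Sum>k\<le>n. (if r = n then u k else of_bool (r = k)) * G c k)"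
      using rc by (intro sum.cong) (auto simp: W_def A_def)
    also have "\<dots> = B $$ (r, c)"
    proof (cases "r = n")
      case True
      then show ?thesis using rc zero[of c] by (auto simp: B_def)
    next
      case False
      have "(\<Sum>k\<le>n. of_bool (r = k) * G c k) = (\<Sum>k\<le>n. if r = k then G c k else 0)"
        by (intro sum.cong) auto
      then show ?thesis using rc False by (auto simp: B_def)
    qed
    finally show "(W * A) $$ (r, c) = B $$ (r, c)" .
  qed (use car in auto)
  then have "Determinant.det W * Determinant.det A = Determinant.det B"
    using det_mult[OF car(2,1)] by simp
  moreover have "Determinant.det W = u n"
  proof -
    have "Determinant.det W = prod_list (diag_mat W)"
      by (rule det_lower_triangular[OF _ car(2)]) (auto simp: W_def)
    also have "\<dots> = (\<Prod>i\<in>{0..<?N}. W $$ (i, i))"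
      using car(2) by (simp add: prod_list_diag_prod)
    also have "\<dots> = u n"
      by (simp add: W_def)
    finally show ?thesis .
  qed
  moreover have "Determinant.det B = (\<Sum>k\<le>n. u k * G n k) * val_det n G"
  proof -
    have "Determinant.det B = (\<Sum>c<?N. B $$ (n, c) * cofactor B n c)"
      by (rule laplace_expansion_row[OF car(3)]) simp
    also have "\<dots> = (\<Sum>k\<le>n. u k * G n k) * cofactor B n n"
      by (simp add: B_def)
    also have "mat_delete B n n = Matrix.mat n n (\<lambda>(r, c). G c r)"
      by (rule eq_matI) (auto simp: mat_delete_def B_def)
    then have "cofactor B n n = val_det n G"
      by (simp add: cofactor_def val_det_def)
    finally show ?thesis .
  qed
  ultimately show ?thesis
    by (simp add: val_det_def A_def)
qed

lemma val_det_add_column: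
  assumes "k < n" "l < n" "k \<noteq> l"
  shows "val_det n (G(k := \<lambda>r. G k r + a * G l r)) = val_det n G"
proof -
  let ?A = "Matrix.mat n n (\<lambda>(r, c). G c r)"
  have "addcol a k l ?A = Matrix.mat n n (\<lambda>(r, c). (G(k := \<lambda>r. G k r + a * G l r)) c r)"
    using assms by (intro eq_matI) auto
  then show ?thesis
    using det_addcol[OF assms(2,3), of ?A a] by (simp add: val_det_def)
qed

text \<open>Both systems at once, as functions of \<open>z = \<kappa> x\<close>: for even \<open>m\<close> it is \<open>1, cos 2z, sin 2z, cos 4z, \<dots>\<close>, for
  odd \<open>m\<close> it is \<open>cos z, sin z, cos 3z, \<dots>\<close>.  The case \<open>c = 0\<close> is separate because the
  general clause would put \<open>sin 0\<close> in the place of the constant \<open>1\<close>.\<close>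

definition trig_system :: "nat \<Rightarrow> nat \<Rightarrow> complex \<Rightarrow> complex" where
  "trig_system m c z =
     (if c = 0 \<and> even m then 1
      else if odd (c + m) then cos (of_nat (Suc c) * z)
      else sin (of_nat c * z))"

definition trig_det :: "nat \<Rightarrow> (nat \<Rightarrow> complex) \<Rightarrow> complex" where
  "trig_det m v = val_det (Suc m) (\<lambda>c r. trig_system m c (v r))"

lemma sine_dd_sin_cos_eq_0:
  assumes sep: "sin_separated v {j..j + Suc n}" and e: "e \<le> n" "even (e + n)"
  shows "sine_dd v j (Suc n) (\<lambda>k. cos (of_nat e * v k)) = 0"
    and "sine_dd v j (Suc n) (\<lambda>k. sin (of_nat e * v k)) = 0"
proof -
  let ?E = "\<lambda>s k. exp (\<i> * of_int (s * int e) * v k)"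
  have *: "sine_dd v j (Suc n) (?E s) = 0" if "s \<in> {1, -1}" for s
    by (rule sine_dd_exp_eq_0[OF sep]) (use that e in auto)
  have c: "(\<lambda>k. cos (of_nat e * v k)) = (\<lambda>k. 1 / 2 * (?E 1 k + ?E (- 1) k))"
    by (simp add: cos_exp_eq mult.assoc)
  have s: "(\<lambda>k. sin (of_nat e * v k)) = (\<lambda>k. 1 / (2 * \<i>) * (?E 1 k - ?E (- 1) k))"
    by (simp add: sin_exp_eq mult.assoc)
  show "sine_dd v j (Suc n) (\<lambda>k. cos (of_nat e * v k)) = 0"
    unfolding c sine_dd_cmult sine_dd_add using *[of 1] *[of "- 1"] by simp
  show "sine_dd v j (Suc n) (\<lambda>k. sin (of_nat e * v k)) = 0"
    unfolding s sine_dd_cmult sine_dd_diff using *[of 1] *[of "- 1"] by simp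
qed

lemma sine_dd_trig_system_eq_0:
  assumes sep: "sin_separated v {j..j + Suc n}" and "c \<le> n"
  shows "sine_dd v j (Suc n) (\<lambda>k. trig_system n c (v k)) = 0"
proof (cases "c = 0 \<and> even n")
  case True
  then show ?thesis
    using sine_dd_sin_cos_eq_0(1)[OF sep, of 0] by (simp add: trig_system_def)
next
  case False
  show ?thesis
  proof (cases "odd (c + n)")
    case True
    then have "Suc c \<le> n" using assms(2) by (cases "c = n") auto
    moreover have "(\<lambda>k. trig_system n c (v k)) = (\<lambda>k. cos (of_nat (Suc c) * v k))"
      using False True by (auto simp: trig_system_def fun_eq_iff)
    ultimately show ?thesis
      using sine_dd_sin_cos_eq_0(1)[OF sep, of "Suc c"] True by simp
  next
    case even: False
    then have "(\<lambda>k. trig_system n c (v k)) = (\<lambda>k. sin (of_nat c * v k))"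
      using False by (auto simp: trig_system_def fun_eq_iff)
    then show ?thesis
      using sine_dd_sin_cos_eq_0(2)[OF sep, of c] even assms(2) by simp
  qed
qed

lemma sine_dd_eq_sum:
  "j + m \<le> n \<Longrightarrow> (\<Sum>k\<le>n. sine_weight v j m k * f k) = sine_dd v j m f"
  unfolding sine_dd_def by (rule sum.mono_neutral_right) (auto simp: sine_weight_def)

lemma sine_weight_last: "sine_weight v j m (j + m) = 1 / (\<Prod>i\<in>{j..<j + m}. sin (v (j + m) - v i))"
proof -
  have "{j..j + m} - {j + m} = {j..<j + m}" by auto
  then show ?thesis by (simp add: sine_weight_def)
qed

text \<open>The determinant is computed in steps of two orders, because \<open>trig_system (n + 2)\<close> extends
  \<open>trig_system n\<close> by \<open>cos ((n + 2) z)\<close> and \<open>sin ((n + 2) z)\<close>, whereas systems of consecutive orders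
  have disjoint sets of frequencies.  After the cosine column is turned into \<open>exp (\<i> (n + 2) z)\<close>, the functionals
  \<open>L0\<close> and \<open>L1\<close>, which are the divided differences of order \<open>n + 1\<close> on the nodes
  without the last and without the first one, clear the last two rows.\<close>

lemma trig_det_recurrence_2:
  assumes sep: "sin_separated v {..n + 2}"
  shows "trig_det (n + 2) v = 4 ^ (n + 1) * (\<Prod>i<n + 2. sin (v (n + 2) - v i))
           * (\<Prod>i<n + 1. sin (v (n + 1) - v i)) * trig_det n v"
proof -
  define L0 where "L0 = sine_dd v 0 (n + 1)"
  define L1 where "L1 = sine_dd v 1 (n + 1)"
  define e where "e s = (\<lambda>k. exp (s * of_nat (n + 2) * v k))" for s :: complex
  define G where "G = (\<lambda>c r. trig_system (n + 2) c (v r))"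
  define H where "H = G(n + 1 := \<lambda>r. G (n + 1) r + \<i> * G (n + 2) r)"
  \<comment> \<open>the combination of \<open>L0\<close> and \<open>L1\<close> that also annihilates the exponential column\<close>
  define u where "u = (\<lambda>k. L1 (e \<i>) * sine_weight v 0 (n + 1) k - L0 (e \<i>) * sine_weight v 1 (n + 1) k)"
  have sep0: "sin_separated v {0..0 + Suc n}" and sep1: "sin_separated v {1..1 + Suc n}"
    using sin_separated_subset[OF sep] by auto
  have u_sum: "(\<Sum>k\<le>n + 2. u k * f k) = L1 (e \<i>) * L0 f - L0 (e \<i>) * L1 f" for f
  proof -
    have "(\<Sum>k\<le>n + 2. u k * f k)
        = L1 (e \<i>) * (\<Sum>k\<le>n + 2. sine_weight v 0 (n + 1) k * f k)
          - L0 (e \<i>) * (\<Sum>k\<le>n + 2. sine_weight v 1 (n + 1) k * f k)"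
      by (simp only: u_def sum_distrib_left left_diff_distrib sum_subtractf mult.assoc)
    then show ?thesis by (simp only: sine_dd_eq_sum L0_def L1_def)
  qed
  have H_small: "H c = (\<lambda>r. trig_system n c (v r))" if "c \<le> n" for c
    using that by (auto simp: H_def G_def trig_system_def fun_eq_iff)
  have H_cos: "H (n + 1) = e \<i>"
    by (auto simp: H_def G_def e_def trig_system_def fun_eq_iff exp_Euler mult.assoc add_ac)
  have H_sin: "H (n + 2) = (\<lambda>k. sin (of_nat (n + 2) * v k))"
    by (auto simp: H_def G_def trig_system_def fun_eq_iff)
  have L_small: "L0 (H c) = 0" "L1 (H c) = 0" if "c \<le> n" for c
    using that sine_dd_trig_system_eq_0[OF sep0] sine_dd_trig_system_eq_0[OF sep1]
    by (simp_all add: L0_def L1_def H_small)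
  define p where "p = (\<Sum>k\<in>{1..n + 1}. v k)"
  have sums: "(\<Sum>k\<in>{0..0 + (n + 1)}. v k) = v 0 + p" "(\<Sum>k\<in>{1..1 + (n + 1)}. v k) = p + v (n + 2)"
    by (simp_all add: p_def sum.atLeast_Suc_atMost)
  have top: "L0 (e s) = (2 * s) ^ (n + 1) * exp (s * (v 0 + p))"
      "L1 (e s) = (2 * s) ^ (n + 1) * exp (s * (p + v (n + 2)))" if "s\<^sup>2 = - 1" for s
    using sine_dd_exp_top[of v 0 "n + 1" s] sine_dd_exp_top[of v 1 "n + 1" s] that sep0 sep1
    by (simp_all only: L0_def L1_def e_def sums) (simp_all add: add_ac)
  have i: "\<i>\<^sup>2 = - 1" "(- \<i>)\<^sup>2 = - 1" by simp_all
  have L0_nz: "L0 (e \<i>) \<noteq> 0" by (simp add: top)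
  have sin_e: "H (n + 2) = (\<lambda>k. 1 / (2 * \<i>) * (e \<i> k - e (- \<i>) k))"
    unfolding H_sin by (simp add: e_def sin_exp_eq mult.assoc)
  have lin: "L0 (H (n + 2)) = 1 / (2 * \<i>) * (L0 (e \<i>) - L0 (e (- \<i>)))"
      "L1 (H (n + 2)) = 1 / (2 * \<i>) * (L1 (e \<i>) - L1 (e (- \<i>)))"
    unfolding L0_def L1_def sin_e sine_dd_cmult sine_dd_diff by simp_all
  have u_sin: "(\<Sum>k\<le>n + 2. u k * H (n + 2) k) = - (4 ^ (n + 1) * sin (v (n + 2) - v 0))"
  proof -
    have "(\<Sum>k\<le>n + 2. u k * H (n + 2) k)
        = - (L1 (e \<i>) * L0 (e (- \<i>)) - L0 (e \<i>) * L1 (e (- \<i>))) / (2 * \<i>)"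
      unfolding u_sum lin by (simp add: field_simps)
    also have "L1 (e \<i>) * L0 (e (- \<i>)) - L0 (e \<i>) * L1 (e (- \<i>))
        = ((2 * \<i>) * (2 * - \<i>)) ^ (n + 1)
          * (exp (\<i> * (v (n + 2) - v 0)) - exp (- (\<i> * (v (n + 2) - v 0))))"
    proof -
      have "L1 (e \<i>) * L0 (e (- \<i>)) - L0 (e \<i>) * L1 (e (- \<i>))
          = (2 * \<i>) ^ (n + 1) * (2 * - \<i>) ^ (n + 1)
            * (exp (\<i> * (p + v (n + 2))) * exp (- \<i> * (v 0 + p))
               - exp (\<i> * (v 0 + p)) * exp (- \<i> * (p + v (n + 2))))"
        unfolding top[OF i(1)] top[OF i(2)] by (simp only: algebra_simps)
      moreover have "exp (\<i> * (p + v (n + 2))) * exp (- \<i> * (v 0 + p))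
               - exp (\<i> * (v 0 + p)) * exp (- \<i> * (p + v (n + 2)))
          = exp (\<i> * (v (n + 2) - v 0)) - exp (- (\<i> * (v (n + 2) - v 0)))"
        by (simp add: algebra_simps flip: exp_add)
      ultimately show ?thesis by (simp only: power_mult_distrib)
    qed
    also have "(2 * \<i>) * (2 * - \<i>) = (4 :: complex)" by simp
    finally show ?thesis by (simp add: sin_exp_eq)
  qed
  have step1: "u (n + 2) * val_det (n + 3) H
      = - (4 ^ (n + 1) * sin (v (n + 2) - v 0)) * val_det (n + 2) H"
  proof -
    have "(\<Sum>k\<le>n + 2. u k * H c k) = 0" if "c < n + 2" for c
    proof (cases "c = n + 1")
      case True
      show ?thesis unfolding u_sum True H_cos by simp
    next
      case False
      then have "c \<le> n" using that by simp
      then show ?thesis unfolding u_sum by (simp add: L_small)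
    qed
    from val_det_eliminate_last_row[where n = "n + 2" and u = u and G = H, OF this] u_sin
    have "u (n + 2) * val_det (Suc (n + 2)) H
        = - (4 ^ (n + 1) * sin (v (n + 2) - v 0)) * val_det (n + 2) H"
      by metis
    moreover have "Suc (n + 2) = n + 3" by simp
    ultimately show ?thesis by metis
  qed
  have step2: "sine_weight v 0 (n + 1) (n + 1) * val_det (n + 2) H = L0 (e \<i>) * val_det (n + 1) H"
  proof -
    have sum: "(\<Sum>k\<le>n + 1. sine_weight v 0 (n + 1) k * f k) = L0 f" for f
      unfolding L0_def by (rule sine_dd_eq_sum) simp
    have "(\<Sum>k\<le>n + 1. sine_weight v 0 (n + 1) k * H c k) = 0" if "c < n + 1" for c
      unfolding sum using that by (simp add: L_small)
    from val_det_eliminate_last_row[where n = "n + 1" and G = H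
      and u = "sine_weight v 0 (n + 1)", OF this] show ?thesis
      unfolding sum H_cos by simp
  qed
  have det_H: "val_det (n + 3) H = trig_det (n + 2) v"
    unfolding H_def by (subst val_det_add_column) (simp_all add: trig_det_def G_def numeral_3_eq_3)
  have det_small: "val_det (n + 1) H = trig_det n v"
    unfolding trig_det_def by (simp, rule val_det_cong) (simp add: H_small)
  define P where "P = (\<Prod>i\<in>{1..<n + 2}. sin (v (n + 2) - v i))"
  define Q where "Q = (\<Prod>i<n + 1. sin (v (n + 1) - v i))"
  have nz: "P \<noteq> 0" "Q \<noteq> 0"
    using sep by (auto simp: P_def Q_def sin_separated_def)
  have u_last: "u (n + 2) = - L0 (e \<i>) / P"
    using sine_weight_last[of v 1 "n + 1"] by (simp add: u_def P_def sine_weight_def)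
  have w_last: "sine_weight v 0 (n + 1) (n + 1) = 1 / Q"
    using sine_weight_last[of v 0 "n + 1"] by (simp add: Q_def atLeast0LessThan)
  have PS: "(\<Prod>i<n + 2. sin (v (n + 2) - v i)) = sin (v (n + 2) - v 0) * P"
    unfolding P_def by (simp add: lessThan_atLeast0 prod.atLeast_Suc_lessThan del: prod.op_ivl_Suc)
  have "L0 (e \<i>) * trig_det (n + 2) v
      = 4 ^ (n + 1) * sin (v (n + 2) - v 0) * P * val_det (n + 2) H"
    using step1 nz(1) unfolding u_last det_H by (simp add: field_simps)
  also have "val_det (n + 2) H = Q * L0 (e \<i>) * trig_det n v"
    using step2 nz(2) unfolding w_last det_small by (simp add: field_simps)
  finally have "L0 (e \<i>) * trig_det (n + 2) v
      = L0 (e \<i>) * (4 ^ (n + 1) * (sin (v (n + 2) - v 0) * P) * Q * trig_det n v)"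
    by (simp add: mult_ac)
  then show ?thesis
    using L0_nz unfolding PS Q_def by simp
qed

definition dd_factor :: "nat \<Rightarrow> complex" where
  "dd_factor m = (if odd m then 2 ^ (m - 1) else 2 ^ m)"

lemma dd_factor_Suc: "dd_factor (m + 1) * dd_factor m = 4 ^ m"
proof -
  have "(4::complex) ^ m = 2 ^ m * 2 ^ m" by (simp flip: power_mult_distrib)
  then show ?thesis by (cases m) (auto simp: dd_factor_def)
qed

text \<open>The factors of consecutive orders multiply to the power of four of the two-step recurrence, and the
  instance for the preceding order turns the remaining product of sines into a determinant of that
  order.  The normalizing powers of two in the definition of the divided difference are exactly
  these factors.\<close>

lemma trig_det_recurrence:
  assumes "sin_separated v {..n + 1}"
  shows "trig_det (n + 1) v
           = dd_factor (n + 1) * (\<Prod>i<n + 1. sin (v (n + 1) - v i)) * trig_det n v"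
  using assms
proof (induction n)
  case 0
  have "trig_det 1 v = sin (v 1 - v 0)"
  proof -
    let ?A = "Matrix.mat 2 2 (\<lambda>(r, c). trig_system 1 c (v r))"
    have "Determinant.det ?A = (\<Sum>c<2. ?A $$ (0, c) * cofactor ?A 0 c)"
      by (rule laplace_expansion_row) auto
    also have "\<dots> = cos (v 0) * sin (v 1) - sin (v 0) * cos (v 1)"
      by (simp add: numeral_2_eq_2 cofactor_def mat_delete_def det_single trig_system_def)
    finally show ?thesis
      by (simp add: trig_det_def val_det_def numeral_2_eq_2 sin_diff mult.commute)
  qed
  moreover have "trig_det 0 v = 1"
    by (simp add: trig_det_def val_det_def det_single trig_system_def)
  ultimately show ?case by (simp add: dd_factor_def)
next
  case (Suc n)
  have "trig_det (n + 1) v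
      = dd_factor (n + 1) * (\<Prod>i<n + 1. sin (v (n + 1) - v i)) * trig_det n v"
    by (rule Suc.IH) (rule sin_separated_subset[OF Suc.prems], auto)
  moreover have "trig_det (n + 2) v = 4 ^ (n + 1) * (\<Prod>i<n + 2. sin (v (n + 2) - v i))
           * (\<Prod>i<n + 1. sin (v (n + 1) - v i)) * trig_det n v"
    by (rule trig_det_recurrence_2) (use Suc.prems in simp)
  moreover have "(4::complex) ^ (n + 1) = dd_factor (n + 2) * dd_factor (n + 1)"
    using dd_factor_Suc[of "n + 1"] by simp
  ultimately show ?case by (simp add: mult_ac)
qed

lemma trig_det_nonzero:
  "sin_separated v {..n} \<Longrightarrow> trig_det n v \<noteq> 0"
proof (induction n)
  case 0
  then show ?case by (simp add: trig_det_def val_det_def det_single trig_system_def)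
next
  case (Suc n)
  have "trig_det n v \<noteq> 0"
    by (rule Suc.IH) (rule sin_separated_subset[OF Suc.prems], auto)
  then show ?case
    using trig_det_recurrence[of v n] Suc.prems
    by (auto simp: dd_factor_def sin_separated_def)
qed

section \<open>The divided difference at distinct nodes\<close>

definition half_angle :: "real \<Rightarrow> real" where
  "half_angle h = ln (1 + h) / (2 * h)"

lemma hcis_eq: "hcis h x = exp (\<i> * (2 * of_real (half_angle h) * of_real x))"
  by (simp add: hcis_def half_angle_def mult_ac)

lemma hcos_eq: "hcos h x = cos (2 * of_real (half_angle h) * of_real x)"
  by (simp add: hcos_def hcis_eq cos_exp_eq)

lemma hsin_eq: "hsin h x = sin (2 * of_real (half_angle h) * of_real x)"
  by (simp add: hsin_def hcis_eq sin_exp_eq)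

lemma int_system_eq:
  assumes "even m"
  shows "int_system h c x = trig_system m c (of_real (half_angle h * x))"
proof (cases "odd c")
  case True
  then obtain q where "c = 2 * q + 1" by (elim oddE)
  then show ?thesis
    using assms by (auto simp: int_system_def trig_system_def hcos_eq algebra_simps)
next
  case False
  then obtain q where "c = 2 * q" by (auto elim: evenE)
  then show ?thesis
    using assms by (auto simp: int_system_def trig_system_def hsin_eq algebra_simps)
qed

lemma half_system_eq:
  assumes "odd m"
  shows "half_system h c x = trig_system m c (of_real (half_angle h * x))"
proof (cases "odd c")
  case True
  then obtain q where "c = 2 * q + 1" by (elim oddE)
  then show ?thesis
    using assms by (auto simp: half_system_def trig_system_def hsin_eq algebra_simps)
next
  case False
  then obtain q where "c = 2 * q" by (auto elim: evenE)
  then show ?thesis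
    using assms by (auto simp: half_system_def trig_system_def hcos_eq algebra_simps)
qed

text \<open>The weighted sum annihilates all columns of the numerator but the last one.  Eliminating the last row with its
  weights leaves the determinant of the preceding order, and the quotient of that determinant by the denominator is
  known from \<open>trig_det_recurrence\<close>.\<close>

lemma trig_dd_distinct_eq_sine_dd:
  assumes m: "m \<ge> 1"
    and sep: "sin_separated (\<lambda>i. of_real (half_angle h * x i)) {..m}"
  shows "trig_dd_distinct h m x f
           = sine_dd (\<lambda>i. of_real (half_angle h * x i)) 0 m (\<lambda>k. f (x k))"
proof -
  define v where "v = (\<lambda>i. complex_of_real (half_angle h * x i))"
  obtain n where n: "m = n + 1" using m by (metis add.commute le_Suc_ex)
  define G where "G = (\<lambda>c r. trig_system n c (v r))(m := \<lambda>r. f (x r))"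
  have sep': "sin_separated v {0..0 + Suc n}" "sin_separated v {..n + 1}" "sin_separated v {..n}"
    using sin_separated_subset[OF sep] by (auto simp: v_def n)
  have dd: "trig_dd_distinct h m x f = dd_factor m * val_det (m + 1) G / trig_det m v"
  proof (cases "odd m")
    case True
    then have e: "even n" by (simp add: n)
    have "colloc_det m ((int_system h)(m := f)) x = val_det (m + 1) G"
      unfolding colloc_det_def val_det_def[symmetric]
      by (rule val_det_cong) (simp add: G_def int_system_eq[OF e] v_def)
    moreover have "colloc_det m (half_system h) x = trig_det m v"
      unfolding colloc_det_def val_det_def[symmetric] trig_det_def
      by (simp, rule val_det_cong) (simp add: half_system_eq[OF True] v_def)
    ultimately show ?thesis using True by (simp add: trig_dd_distinct_def dd_factor_def)
  next
    case False
    then have e: "odd n" by (simp add: n)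
    have "colloc_det m ((half_system h)(m := f)) x = val_det (m + 1) G"
      unfolding colloc_det_def val_det_def[symmetric]
      by (rule val_det_cong) (simp add: G_def half_system_eq[OF e] v_def)
    moreover have "colloc_det m (int_system h) x = trig_det m v"
      unfolding colloc_det_def val_det_def[symmetric] trig_det_def
      by (simp, rule val_det_cong) (use False in \<open>simp add: int_system_eq v_def\<close>)
    ultimately show ?thesis using False by (simp add: trig_dd_distinct_def dd_factor_def)
  qed
  have G_last: "G m = (\<lambda>r. f (x r))" by (simp add: G_def)
  have sum: "(\<Sum>k\<le>m. sine_weight v 0 m k * g k) = sine_dd v 0 m g" for g
    by (rule sine_dd_eq_sum) simp
  have "(\<Sum>k\<le>m. sine_weight v 0 m k * G c k) = 0" if "c < m" for c
    unfolding sum using that sine_dd_trig_system_eq_0[OF sep'(1), of c] by (simp add: G_def n)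
  from val_det_eliminate_last_row[where n = m and u = "sine_weight v 0 m" and G = G, OF this]
  have "sine_weight v 0 m m * val_det (m + 1) G = sine_dd v 0 m (\<lambda>k. f (x k)) * val_det m G"
    unfolding sum by (simp add: G_last)
  also have "val_det m G = trig_det n v"
    unfolding trig_det_def n Suc_eq_plus1[symmetric]
    by (rule val_det_cong) (simp add: G_def n)
  finally have num: "sine_weight v 0 m m * val_det (m + 1) G
      = sine_dd v 0 m (\<lambda>k. f (x k)) * trig_det n v" .
  define P where "P = (\<Prod>i<m. sin (v m - v i))"
  have P: "P \<noteq> 0"
    using sep'(2) by (auto simp: P_def sin_separated_def n)
  have w: "sine_weight v 0 m m = 1 / P"
    using sine_weight_last[of v 0 m] by (simp add: P_def atLeast0LessThan)
  have den: "trig_det m v = dd_factor m * P * trig_det n v"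
    using trig_det_recurrence[OF sep'(2)] by (simp add: n P_def)
  have nz: "trig_det n v \<noteq> 0" "dd_factor m \<noteq> 0"
    using trig_det_nonzero[OF sep'(3)] by (auto simp: dd_factor_def)
  have "val_det (m + 1) G = P * (sine_dd v 0 m (\<lambda>k. f (x k)) * trig_det n v)"
    using num P unfolding w by (simp add: field_simps)
  then have "trig_dd_distinct h m x f = sine_dd v 0 m (\<lambda>k. f (x k))"
    unfolding dd den using P nz by (simp add: field_simps)
  then show ?thesis by (simp add: v_def)
qed

section \<open>Trigonometric polynomial pieces of the B-splines\<close>

text \<open>The B-spline of order \<open>n + 1\<close> on the scaled knots \<open>v\<^sub>j, \<dots>, v\<^sub>j\<^sub>+\<^sub>n\<^sub>+\<^sub>1\<close>, where \<open>\<eta> = \<kappa> h\<close> and \<open>z = \<kappa> x\<close>.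
  The relation \<open>x < \<xi>\<^sub>k\<close> is passed as the predicate \<open>\<sigma>\<close>, so that \<open>z\<close> can vary over the complex
  plane while the piece stays the same.\<close>

fun spline_piece ::
    "complex \<Rightarrow> (nat \<Rightarrow> complex) \<Rightarrow> (nat \<Rightarrow> bool) \<Rightarrow> nat \<Rightarrow> nat \<Rightarrow> complex \<Rightarrow> complex" where
  "spline_piece \<eta> v \<sigma> 0 j z = (of_bool (\<sigma> (Suc j)) - of_bool (\<sigma> j)) / sin (v (Suc j) - v j)"
| "spline_piece \<eta> v \<sigma> (Suc n) j z =
     (sin (v (j + Suc (Suc n)) - (z - of_nat n * \<eta>)) * spline_piece \<eta> v \<sigma> n (Suc j) z
      - sin (v j - (z - of_nat n * \<eta>)) * spline_piece \<eta> v \<sigma> n j z)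
     / sin (v (j + Suc (Suc n)) - v j)"

lemma spline_piece_cong:
  "(\<And>k. k \<in> {j..j + Suc n} \<Longrightarrow> \<sigma> k = \<tau> k) \<Longrightarrow> spline_piece \<eta> v \<sigma> n j z = spline_piece \<eta> v \<tau> n j z"
proof (induction n arbitrary: j)
  case (Suc n)
  have "spline_piece \<eta> v \<sigma> n j z = spline_piece \<eta> v \<tau> n j z"
    "spline_piece \<eta> v \<sigma> n (Suc j) z = spline_piece \<eta> v \<tau> n (Suc j) z"
    by (rule Suc.IH, rule Suc.prems, force)+
  then show ?case by simp
qed simp

text \<open>Left of the support all knots lie to the right, and right of it none do.  The same argument
  applies if all knots coincide, so that the quotient by \<open>sin 0 = 0\<close> in the recursion is never taken of a
  nonzero number.\<close>

lemma spline_piece_eq_0: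
  "(\<And>k. k \<in> {j..j + Suc n} \<Longrightarrow> \<sigma> k = s) \<Longrightarrow> spline_piece \<eta> v \<sigma> n j z = 0"
proof (induction n arbitrary: j)
  case (Suc n)
  have "spline_piece \<eta> v \<sigma> n j z = 0" "spline_piece \<eta> v \<sigma> n (Suc j) z = 0"
    by (rule Suc.IH, rule Suc.prems, force)+
  then show ?case by simp
qed simp

lemma spline_piece_shift:
  "spline_piece \<eta> (\<lambda>i. v (d + i)) (\<lambda>i. \<sigma> (d + i)) n j z = spline_piece \<eta> v \<sigma> n (d + j) z"
  by (induction n arbitrary: j) (simp_all add: add.assoc)

lemma spline_piece_holomorphic: "spline_piece \<eta> v \<sigma> n j holomorphic_on A"
proof (induction n arbitrary: j)
  case 0
  have "spline_piece \<eta> v \<sigma> 0 j = (\<lambda>z. (of_bool (\<sigma> (Suc j)) - of_bool (\<sigma> j)) / sin (v (Suc j) - v j))"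
    by (simp add: fun_eq_iff)
  then show ?case by simp
next
  case (Suc n)
  have "spline_piece \<eta> v \<sigma> (Suc n) j =
    (\<lambda>z. (sin (v (j + Suc (Suc n)) - (z - of_nat n * \<eta>)) * spline_piece \<eta> v \<sigma> n (Suc j) z
      - sin (v j - (z - of_nat n * \<eta>)) * spline_piece \<eta> v \<sigma> n j z)
     * inverse (sin (v (j + Suc (Suc n)) - v j)))"
    by (simp add: fun_eq_iff divide_inverse)
  then show ?case
    by (simp only:) (intro holomorphic_intros Suc.IH)
qed

text \<open>The filter lives on an arbitrary type; it will be a filter on node vectors.\<close>

lemma tendsto_sin_complex:
  fixes f :: "'a \<Rightarrow> complex"
  shows "(f \<longlongrightarrow> a) F \<Longrightarrow> ((\<lambda>x. sin (f x)) \<longlongrightarrow> sin a) F"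
  by (rule isCont_tendsto_compose[OF isCont_sin])

text \<open>The second hypothesis expresses that knots that are equal modulo \<open>\<pi>\<close>, and hence make a denominator vanish, lie on one
  side of \<open>x\<close> together with all knots between them.  In that case the piece is zero for
  all knot vectors; in all other cases the denominator stays away from zero.\<close>

lemma tendsto_spline_piece:
  assumes "\<And>k. k \<in> {j..j + Suc n} \<Longrightarrow> ((\<lambda>a. V a k) \<longlongrightarrow> v k) F"
    and "\<And>i k l. i \<in> {j..j + Suc n} \<Longrightarrow> k \<in> {j..j + Suc n} \<Longrightarrow> sin (v k - v i) = 0 \<Longrightarrow>
           i \<le> l \<Longrightarrow> l \<le> k \<Longrightarrow> \<sigma> l = \<sigma> i"
  shows "((\<lambda>a. spline_piece \<eta> (V a) \<sigma> n j z) \<longlongrightarrow> spline_piece \<eta> v \<sigma> n j z) F"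
  using assms
proof (induction n arbitrary: j)
  case 0
  show ?case
  proof (cases "sin (v (Suc j) - v j) = 0")
    case True
    then have "\<sigma> (Suc j) = \<sigma> j" using 0(2)[of j "Suc j" "Suc j"] by simp
    then show ?thesis by simp
  next
    case False
    moreover have "((\<lambda>a. V a j) \<longlongrightarrow> v j) F" "((\<lambda>a. V a (Suc j)) \<longlongrightarrow> v (Suc j)) F"
      using 0(1) by auto
    ultimately show ?thesis
      unfolding spline_piece.simps by (intro tendsto_intros tendsto_sin_complex)
  qed
next
  case (Suc n)
  let ?b = "j + Suc (Suc n)"
  show ?case
  proof (cases "sin (v ?b - v j) = 0")
    case True
    have const: "\<sigma> l = \<sigma> j" if "l \<in> {j..?b}" for l
      by (rule Suc.prems(2)[of j ?b]) (use that True in auto)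
    have "spline_piece \<eta> w \<sigma> (Suc n) j z = 0" for w
      by (rule spline_piece_eq_0[OF const])
    then show ?thesis by (simp del: spline_piece.simps)
  next
    case False
    have "((\<lambda>a. spline_piece \<eta> (V a) \<sigma> n j z) \<longlongrightarrow> spline_piece \<eta> v \<sigma> n j z) F"
      by (rule Suc.IH; rule Suc.prems; force)
    moreover have "((\<lambda>a. spline_piece \<eta> (V a) \<sigma> n (Suc j) z) \<longlongrightarrow> spline_piece \<eta> v \<sigma> n (Suc j) z) F"
      by (rule Suc.IH; rule Suc.prems; force)
    moreover have "((\<lambda>a. V a j) \<longlongrightarrow> v j) F" "((\<lambda>a. V a ?b) \<longlongrightarrow> v ?b) F"
      using Suc.prems(1) by auto
    ultimately show ?thesis
      unfolding spline_piece.simps using False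
      by (intro tendsto_intros tendsto_sin_complex)
  qed
qed

text \<open>The truncated power of one order is that of the preceding order times \<open>sin (v\<^sub>k - (z - n \<eta>))\<close>, to which the
  recurrence of the divided differences applies.\<close>

lemma sine_dd_truncated_power:
  assumes "sin_separated v {j..j + Suc n}"
  shows "sine_dd v j (Suc n) (\<lambda>k. of_bool (\<sigma> k) * (\<Prod>l<n. sin (v k - (z - of_nat l * \<eta>))))
           = spline_piece \<eta> v \<sigma> n j z"
  using assms
proof (induction n arbitrary: j)
  case 0
  have nz: "sin (v (Suc j) - v j) \<noteq> 0"
    using 0 by (auto simp: sin_separated_def)
  have "sin (v (Suc j) - v j) * sine_weight v j (Suc 0) (Suc j) = 1"
    using sine_weight_drop_first[OF 0, of "Suc j"] by (simp add: sine_weight_def)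
  moreover have "sin (v (Suc j) - v j) * sine_weight v j (Suc 0) j = - 1"
    using sine_weight_drop_last[OF 0, of j] by (simp add: sine_weight_def)
  ultimately have "sine_weight v j (Suc 0) (Suc j) = 1 / sin (v (Suc j) - v j)"
    "sine_weight v j (Suc 0) j = - 1 / sin (v (Suc j) - v j)"
    using nz by (simp_all only: eq_divide_eq mult.commute) simp_all
  then show ?case by (simp add: sine_dd_def diff_divide_distrib)
next
  case (Suc n)
  let ?b = "j + Suc (Suc n)"
  let ?g = "\<lambda>k. sin (v k - (z - of_nat n * \<eta>))"
  let ?f = "\<lambda>n k. of_bool (\<sigma> k) * (\<Prod>l<n. sin (v k - (z - of_nat l * \<eta>)))"
  have nz: "sin (v ?b - v j) \<noteq> 0"
    using Suc.prems by (auto simp: sin_separated_def)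
  have "sin (v ?b - v j) * sine_dd v j (Suc (Suc n)) (\<lambda>k. ?g k * ?f n k)
      = ?g ?b * sine_dd v (Suc j) (Suc n) (?f n) - ?g j * sine_dd v j (Suc n) (?f n)"
    by (rule sine_dd_recurrence[OF Suc.prems]) (rule sin_interpolation_sin)
  also have "sine_dd v (Suc j) (Suc n) (?f n) = spline_piece \<eta> v \<sigma> n (Suc j) z"
    by (rule Suc.IH) (rule sin_separated_subset[OF Suc.prems], auto)
  also have "sine_dd v j (Suc n) (?f n) = spline_piece \<eta> v \<sigma> n j z"
    by (rule Suc.IH) (rule sin_separated_subset[OF Suc.prems], auto)
  also have "(\<lambda>k. ?g k * ?f n k) = ?f (Suc n)"
    by (simp add: fun_eq_iff)
  finally show ?case
    using nz unfolding spline_piece.simps by (simp only: eq_divide_eq mult.commute) simp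
qed

text \<open>Replacing \<open>z\<close> by \<open>z + \<eta>\<close> shifts the product of sines in the truncated power by one place: the factor
  \<open>sin (v\<^sub>k - (z + \<eta>))\<close> enters and \<open>sin (v\<^sub>k - (z - n \<eta>))\<close> leaves.  Their difference is a constant times
  \<open>c (v\<^sub>k)\<close>, which is absorbed by the recurrence.\<close>

lemma spline_piece_difference_separated:
  fixes z \<eta> :: complex
  assumes sep: "sin_separated v {j..j + Suc (Suc n)}"
  defines "b \<equiv> j + Suc (Suc n)"
  defines "c \<equiv> (\<lambda>u. cos (u - (z - (of_nat n - 1) * \<eta> / 2)))"
  shows "sin (v b - v j)
           * (spline_piece \<eta> v \<sigma> (Suc n) j (z + \<eta>) - spline_piece \<eta> v \<sigma> (Suc n) j z)
         = 2 * sin (of_nat (Suc n) * \<eta> / 2)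
           * (c (v j) * spline_piece \<eta> v \<sigma> n j z - c (v b) * spline_piece \<eta> v \<sigma> n (Suc j) z)"
proof -
  define s where "s = 2 * sin (of_nat (Suc n) * \<eta> / 2)"
  define f where "f = (\<lambda>n z k. of_bool (\<sigma> k) * (\<Prod>l<n. sin (v k - (z - of_nat l * \<eta>))))"
  have diff: "f (Suc n) (z + \<eta>) k - f (Suc n) z k = - s * (c (v k) * f n z k)" for k
  proof -
    have "sin (v k - (z + \<eta>)) - sin (v k - (z - of_nat n * \<eta>)) = - s * c (v k)"
    proof -
      let ?A = "v k - (z + \<eta>)" and ?B = "v k - (z - of_nat n * \<eta>)"
      have "(?A - ?B) / 2 = - (of_nat (Suc n) * \<eta> / 2)"
        "(?A + ?B) / 2 = v k - (z - (of_nat n - 1) * \<eta> / 2)"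
        by (simp_all add: field_simps)
      then have "sin ?A - sin ?B
          = 2 * sin (- (of_nat (Suc n) * \<eta> / 2)) * cos (v k - (z - (of_nat n - 1) * \<eta> / 2))"
        by (simp only: sin_diff_sin)
      then show ?thesis
        by (simp only: sin_minus s_def c_def) simp
    qed
    moreover have "f (Suc n) (z + \<eta>) k = sin (v k - (z + \<eta>)) * f n z k"
      unfolding f_def prod.lessThan_Suc_shift by (simp add: algebra_simps)
    moreover have "f (Suc n) z k = sin (v k - (z - of_nat n * \<eta>)) * f n z k"
      by (simp add: f_def)
    ultimately have "f (Suc n) (z + \<eta>) k - f (Suc n) z k = - s * c (v k) * f n z k"
      by (metis left_diff_distrib)
    then show ?thesis by (simp only: mult.assoc)
  qed
  have "sin (v b - v j)
      * (spline_piece \<eta> v \<sigma> (Suc n) j (z + \<eta>) - spline_piece \<eta> v \<sigma> (Suc n) j z)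
      = sin (v b - v j) * (- s * sine_dd v j (Suc (Suc n)) (\<lambda>k. c (v k) * f n z k))"
  proof -
    have piece: "spline_piece \<eta> v \<sigma> (Suc n) j w = sine_dd v j (Suc (Suc n)) (f (Suc n) w)" for w
      unfolding f_def by (rule sine_dd_truncated_power[OF sep, symmetric])
    have "spline_piece \<eta> v \<sigma> (Suc n) j (z + \<eta>) - spline_piece \<eta> v \<sigma> (Suc n) j z
        = sine_dd v j (Suc (Suc n)) (\<lambda>k. f (Suc n) (z + \<eta>) k - f (Suc n) z k)"
      unfolding piece by (rule sine_dd_diff[symmetric])
    also have "\<dots> = sine_dd v j (Suc (Suc n)) (\<lambda>k. - s * (c (v k) * f n z k))"
      by (simp only: diff)
    also have "\<dots> = - s * sine_dd v j (Suc (Suc n)) (\<lambda>k. c (v k) * f n z k)"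
      by (rule sine_dd_cmult)
    finally show ?thesis by (simp only:)
  qed
  also have "\<dots> = - s * (sin (v b - v j) * sine_dd v j (Suc (Suc n)) (\<lambda>k. c (v k) * f n z k))"
    by simp
  also have "sin (v b - v j) * sine_dd v j (Suc (Suc n)) (\<lambda>k. c (v k) * f n z k)
      = c (v b) * sine_dd v (Suc j) (Suc n) (f n z) - c (v j) * sine_dd v j (Suc n) (f n z)"
    unfolding b_def c_def by (rule sine_dd_recurrence[OF sep]) (rule sin_interpolation_cos)
  also have "sine_dd v (Suc j) (Suc n) (f n z) = spline_piece \<eta> v \<sigma> n (Suc j) z"
    unfolding f_def
    by (rule sine_dd_truncated_power) (rule sin_separated_subset[OF sep], auto)
  also have "sine_dd v j (Suc n) (f n z) = spline_piece \<eta> v \<sigma> n j z"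
    unfolding f_def
    by (rule sine_dd_truncated_power) (rule sin_separated_subset[OF sep], auto)
  finally show ?thesis by (simp only: s_def minus_mult_commute minus_diff_eq)
qed

section \<open>Knot vectors of span less than a period\<close>

lemma half_angle_pos:
  assumes "h \<noteq> 0" "h > - 1"
  shows "half_angle h > 0"
proof (cases "h > 0")
  case True
  then show ?thesis by (simp add: half_angle_def)
next
  case False
  then have "ln (1 + h) < 0" using assms by simp
  then show ?thesis using False assms by (simp add: half_angle_def divide_neg_neg)
qed

lemma sin_scaled_diff_nonzero:
  assumes "\<kappa> > 0" "s < t" "\<kappa> * (t - s) < pi"
  shows "sin (complex_of_real (\<kappa> * t) - complex_of_real (\<kappa> * s)) \<noteq> 0"
proof -
  have "sin (\<kappa> * (t - s)) > 0"
    using assms by (intro sin_gt_zero) auto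
  moreover have "sin (complex_of_real (\<kappa> * t) - complex_of_real (\<kappa> * s)) = of_real (sin (\<kappa> * (t - s)))"
    by (simp add: sin_of_real right_diff_distrib flip: of_real_mult of_real_diff)
  ultimately show ?thesis by simp
qed

lemma strict_mono_on_sin_separated:
  assumes "\<kappa> > 0" "strict_mono_on {a..b} y" "\<kappa> * (y b - y a) < pi"
  shows "sin_separated (\<lambda>i. of_real (\<kappa> * y i)) {a..b}"
proof -
  have main: "sin (complex_of_real (\<kappa> * y k) - complex_of_real (\<kappa> * y i)) \<noteq> 0"
    if ik: "i \<in> {a..b}" "k \<in> {a..b}" "i < k" for i k
  proof (rule sin_scaled_diff_nonzero[OF assms(1)])
    show "y i < y k" using assms(2) ik by (auto simp: strict_mono_on_def)
    have "y a \<le> y i" "y k \<le> y b"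
      using strict_mono_on_leD[OF assms(2)] ik by auto
    then have "\<kappa> * (y k - y i) \<le> \<kappa> * (y b - y a)"
      using assms(1) by (intro mult_left_mono) auto
    then show "\<kappa> * (y k - y i) < pi" using assms(3) by simp
  qed
  have "sin (complex_of_real (\<kappa> * y k) - complex_of_real (\<kappa> * y i)) \<noteq> 0"
    if ik: "i \<in> {a..b}" "k \<in> {a..b}" "i \<noteq> k" for i k
    using main[of i k] main[of k i] ik
      sin_minus[of "complex_of_real (\<kappa> * y k) - complex_of_real (\<kappa> * y i)"]
    by (cases "i < k") auto
  then show ?thesis by (simp add: sin_separated_def)
qed

text \<open>Within the admissible span a vanishing sine means coincidence, and coincidence spreads to the knots in between by
  monotonicity.\<close>

lemma knots_compatible:
  assumes "\<kappa> > 0" "mono \<xi>" "\<kappa> * (\<xi> b - \<xi> a) < pi" "i \<in> {a..b}" "k \<in> {a..b}"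
    and "sin (complex_of_real (\<kappa> * \<xi> k) - complex_of_real (\<kappa> * \<xi> i)) = 0" "i \<le> l" "l \<le> k"
  shows "\<xi> l = \<xi> i"
proof (rule ccontr)
  assume "\<xi> l \<noteq> \<xi> i"
  have le: "\<xi> a \<le> \<xi> i" "\<xi> i \<le> \<xi> l" "\<xi> l \<le> \<xi> k" "\<xi> k \<le> \<xi> b"
    using assms by (auto intro: monoD)
  then have "\<kappa> * (\<xi> k - \<xi> i) \<le> \<kappa> * (\<xi> b - \<xi> a)"
    using assms(1) by (intro mult_left_mono) auto
  moreover have "sin (complex_of_real (\<kappa> * \<xi> k) - complex_of_real (\<kappa> * \<xi> i)) \<noteq> 0"
    using assms(1,3) calculation le \<open>\<xi> l \<noteq> \<xi> i\<close>
    by (intro sin_scaled_diff_nonzero) linarith+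
  ultimately show False using assms(6) by simp
qed

text \<open>The knots are made distinct by adding \<open>\<epsilon> i\<close> to the knot of index \<open>i\<close>.  Both sides of the formula for
  distinct knots depend continuously on the knots, as the predicate \<open>\<sigma>\<close> is not changed by the
  perturbation.\<close>

lemma spline_piece_difference:
  fixes \<xi> :: "nat \<Rightarrow> real" and \<kappa> :: real and z \<eta> :: complex and x :: real
  assumes \<kappa>: "\<kappa> > 0" and mono: "mono \<xi>"
    and span: "\<kappa> * (\<xi> (j + Suc (Suc n)) - \<xi> j) < pi"
  defines "b \<equiv> j + Suc (Suc n)"
  defines "v \<equiv> (\<lambda>i. complex_of_real (\<kappa> * \<xi> i))"
  defines "\<sigma> \<equiv> (\<lambda>i. x < \<xi> i)"
  defines "c \<equiv> (\<lambda>u. cos (u - (z - (of_nat n - 1) * \<eta> / 2)))"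
  shows "sin (v b - v j)
           * (spline_piece \<eta> v \<sigma> (Suc n) j (z + \<eta>) - spline_piece \<eta> v \<sigma> (Suc n) j z)
         = 2 * sin (of_nat (Suc n) * \<eta> / 2)
           * (c (v j) * spline_piece \<eta> v \<sigma> n j z - c (v b) * spline_piece \<eta> v \<sigma> n (Suc j) z)"
proof -
  define y where "y = (\<lambda>\<epsilon> i. \<xi> i + \<epsilon> * real i)"
  define V where "V = (\<lambda>\<epsilon> i. complex_of_real (\<kappa> * y \<epsilon> i))"
  let ?F = "at_right (0::real)"
  let ?lhs = "\<lambda>v. sin (v b - v j)
           * (spline_piece \<eta> v \<sigma> (Suc n) j (z + \<eta>) - spline_piece \<eta> v \<sigma> (Suc n) j z)"
  let ?rhs = "\<lambda>v. 2 * sin (of_nat (Suc n) * \<eta> / 2)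
           * (c (v j) * spline_piece \<eta> v \<sigma> n j z - c (v b) * spline_piece \<eta> v \<sigma> n (Suc j) z)"
  have y: "((\<lambda>\<epsilon>. y \<epsilon> k) \<longlongrightarrow> \<xi> k) ?F" for k
  proof -
    have "((\<lambda>\<epsilon>. \<xi> k + \<epsilon> * real k) \<longlongrightarrow> \<xi> k + 0 * real k) ?F"
      by (intro tendsto_intros)
    then show ?thesis by (simp add: y_def)
  qed
  have V: "((\<lambda>\<epsilon>. V \<epsilon> k) \<longlongrightarrow> v k) ?F" for k
    unfolding V_def v_def by (intro tendsto_intros y)
  have compat: "\<sigma> l = \<sigma> i"
    if "i \<in> {j..b}" "k \<in> {j..b}" "sin (v k - v i) = 0" "i \<le> l" "l \<le> k" for i k l
    using knots_compatible[OF \<kappa> mono, of b j i k l] that span by (simp add: \<sigma>_def v_def b_def)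
  have piece: "((\<lambda>\<epsilon>. spline_piece \<eta> (V \<epsilon>) \<sigma> n' j' w) \<longlongrightarrow> spline_piece \<eta> v \<sigma> n' j' w) ?F"
    if "{j'..j' + Suc n'} \<subseteq> {j..b}" for n' j' w
    by (rule tendsto_spline_piece[OF V], rule compat) (use that in auto)
  have lhs: "((\<lambda>\<epsilon>. ?lhs (V \<epsilon>)) \<longlongrightarrow> ?lhs v) ?F"
    by (intro tendsto_intros V piece) (auto simp: b_def)
  have rhs: "((\<lambda>\<epsilon>. ?rhs (V \<epsilon>)) \<longlongrightarrow> ?rhs v) ?F"
    unfolding c_def by (intro tendsto_intros V piece) (auto simp: b_def)
  have "\<forall>\<^sub>F \<epsilon> in ?F. ?lhs (V \<epsilon>) = ?rhs (V \<epsilon>)"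
  proof -
    have "((\<lambda>\<epsilon>. \<kappa> * (y \<epsilon> b - y \<epsilon> j)) \<longlongrightarrow> \<kappa> * (\<xi> b - \<xi> j)) ?F"
      by (intro tendsto_intros y)
    then have "\<forall>\<^sub>F \<epsilon> in ?F. \<kappa> * (y \<epsilon> b - y \<epsilon> j) < pi"
      by (rule order_tendstoD) (use span in \<open>simp add: b_def\<close>)
    moreover have "\<forall>\<^sub>F \<epsilon> in ?F. \<epsilon> > (0::real)"
      by (simp add: eventually_at_right_less)
    ultimately show ?thesis
    proof eventually_elim
      case (elim \<epsilon>)
      have "y \<epsilon> i < y \<epsilon> k" if "i < k" for i k
        using elim(2) that monoD[OF mono, of i k] by (auto simp: y_def intro!: add_le_less_mono)
      then have "strict_mono_on {j..b} (y \<epsilon>)"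
        by (auto simp: strict_mono_on_def)
      then have "sin_separated (V \<epsilon>) {j..j + Suc (Suc n)}"
        using strict_mono_on_sin_separated[OF \<kappa> _ elim(1)] by (simp add: V_def b_def)
      from spline_piece_difference_separated[OF this] show ?case
        by (simp only: b_def c_def)
    qed
  qed
  then have "((\<lambda>\<epsilon>. ?rhs (V \<epsilon>)) \<longlongrightarrow> ?lhs v) ?F"
    by (rule Lim_transform_eventually[OF lhs])
  then show ?thesis
    by (rule tendsto_unique[OF trivial_limit_at_right_real _ rhs])
qed

section \<open>Limits of divided differences\<close>

lemma filterlim_nodes_at_left:
  assumes "i \<le> m"
  shows "filterlim (\<lambda>y. y i) (at_left (x i)) (nodes_at_left m x)"
  unfolding filterlim_iff_le_filtercomap nodes_at_left_def
  by (rule le_infI1, rule INF_lower) (use assms in simp)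

lemma eventually_nodes_strict_mono:
  "\<forall>\<^sub>F y in nodes_at_left m x. strict_mono_on {..m} y"
  by (auto simp: nodes_at_left_def eventually_inf_principal)

text \<open>Needed for limits along this filter to be unique.  The curve \<open>x\<^sub>i - \<epsilon> (m + 1 - i)\<close>
  separates the nodes and moves each of them strictly to the left.\<close>

lemma nodes_at_left_nontrivial:
  fixes x :: "nat \<Rightarrow> real"
  assumes mono: "mono_on {..m} x"
  shows "nodes_at_left m x \<noteq> bot"
proof
  assume bot: "nodes_at_left m x = bot"
  define y where "y = (\<lambda>\<epsilon> i. x i - \<epsilon> * (real (Suc m) - real i))"
  have ev: "\<forall>\<^sub>F \<epsilon> in at_right 0. \<epsilon> > (0::real)"
    by (simp add: eventually_at_right_less)
  have "filterlim y (nodes_at_left m x) (at_right 0)"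
    unfolding nodes_at_left_def filterlim_inf filterlim_INF filterlim_principal
      filterlim_filtercomap_iff
  proof (intro conjI ballI)
    fix i assume "i \<in> {..m}"
    have "((\<lambda>\<epsilon>. x i - \<epsilon> * (real (Suc m) - real i)) \<longlongrightarrow> x i - 0 * (real (Suc m) - real i)) (at_right 0)"
      by (intro tendsto_intros)
    moreover have "\<forall>\<^sub>F \<epsilon> in at_right 0. y \<epsilon> i < x i"
      using ev by eventually_elim (use \<open>i \<in> {..m}\<close> in \<open>simp add: y_def\<close>)
    ultimately show "filterlim ((\<lambda>y. y i) \<circ> y) (at_left (x i)) (at_right 0)"
      unfolding filterlim_at by (auto simp: y_def o_def elim!: eventually_mono)
  next
    show "\<forall>\<^sub>F \<epsilon> in at_right 0. y \<epsilon> \<in> {y. strict_mono_on {..m} y}"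
      using ev
    proof eventually_elim
      case (elim \<epsilon>)
      have "y \<epsilon> i < y \<epsilon> k" if "i \<in> {..m}" "k \<in> {..m}" "i < k" for i k
      proof -
        have "x i \<le> x k" using mono that by (auto simp: mono_on_def)
        moreover have "\<epsilon> * (real (Suc m) - real k) < \<epsilon> * (real (Suc m) - real i)"
          using elim that by (intro mult_strict_left_mono) auto
        ultimately show ?thesis by (simp add: y_def)
      qed
      then show ?case by (auto simp: strict_mono_on_def)
    qed
  qed
  then have "\<forall>\<^sub>F \<epsilon> in at_right (0::real). False"
    unfolding bot filterlim_iff by (rule allE[of _ "\<lambda>_. False"]) simp
  then show False by simp
qed

section \<open>The B-splines and their h-derivative\<close>

lemma hsin_half: "hsin h (u / 2) = sin (of_real (half_angle h * u))"
  by (simp add: hsin_eq)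

lemma hcos_half: "hcos h (u / 2) = cos (of_real (half_angle h * u))"
  by (simp add: hcos_eq)

lemma htrunc_eq:
  "htrunc h n x y = of_bool (x < y)
     * (\<Prod>l<n. sin (of_real (half_angle h * y)
                  - (of_real (half_angle h * x) - of_nat l * of_real (half_angle h * h))))"
proof -
  have "hsin h ((y - (x - real l * h)) / 2) = sin (of_real (half_angle h * y)
      - (of_real (half_angle h * x) - of_nat l * of_real (half_angle h * h)))" for l
    unfolding hsin_half by (simp add: algebra_simps)
  then show ?thesis by (simp add: htrunc_def)
qed

text \<open>Moving the knots slightly to the left does not change on which side of \<open>x\<close> they lie: a
  knot greater than \<open>x\<close> stays so if the motion is small, and a knot at most \<open>x\<close> moves
  away from it.  Hence, near the limit, the divided difference of the truncated power is the piece with the predicate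
  \<open>\<sigma>\<close> of the original knots, which is continuous in the knots.\<close>

lemma trig_bspline_eq_spline_piece:
  fixes \<xi> :: "nat \<Rightarrow> real"
  assumes h: "h \<noteq> 0" "h > - 1" and mono: "mono \<xi>"
    and span: "half_angle h * (\<xi> (j + Suc n) - \<xi> j) < pi"
  shows "trig_bspline h \<xi> j (Suc n) x
    = spline_piece (of_real (half_angle h * h)) (\<lambda>i. of_real (half_angle h * \<xi> i)) (\<lambda>i. x < \<xi> i)
        n j (of_real (half_angle h * x))"
proof (cases "\<xi> (j + Suc n) = \<xi> j")
  case True
  then show ?thesis by (cases n) (simp_all add: trig_bspline_def)
next
  case False
  define \<kappa> where "\<kappa> = half_angle h"
  define \<zeta> where "\<zeta> = (\<lambda>i. \<xi> (j + i))"
  define v where "v = (\<lambda>(y :: nat \<Rightarrow> real) i. complex_of_real (\<kappa> * y i))"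
  define B where "B = (\<lambda>y. spline_piece (of_real (\<kappa> * h)) (v y) (\<lambda>i. x < \<zeta> i) n 0 (of_real (\<kappa> * x)))"
  have \<kappa>: "\<kappa> > 0" unfolding \<kappa>_def by (rule half_angle_pos[OF h])
  have \<zeta>: "mono \<zeta>" using mono by (auto simp: \<zeta>_def mono_def)
  have \<zeta>_span: "\<kappa> * (\<zeta> (Suc n) - \<zeta> 0) < pi" using span by (simp add: \<zeta>_def \<kappa>_def)
  have distinct: "trig_dd_distinct h (Suc n) y (htrunc h n x) = B y"
    if y: "strict_mono_on {..Suc n} y" "\<kappa> * (y (Suc n) - y 0) < pi"
      and side: "\<And>i. i \<le> Suc n \<Longrightarrow> x < y i \<longleftrightarrow> x < \<zeta> i" for y
  proof -
    have sep: "sin_separated (v y) {0..Suc n}"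
      unfolding v_def using y by (intro strict_mono_on_sin_separated[OF \<kappa>]) (simp_all add: atLeast0AtMost)
    have "trig_dd_distinct h (Suc n) y (htrunc h n x)
        = sine_dd (v y) 0 (Suc n) (\<lambda>k. htrunc h n x (y k))"
      using sep unfolding v_def \<kappa>_def
      by (intro trig_dd_distinct_eq_sine_dd) (simp_all add: atLeast0AtMost)
    also have "\<dots> = sine_dd (v y) 0 (Suc n) (\<lambda>k. of_bool (x < \<zeta> k)
        * (\<Prod>l<n. sin (v y k - (of_real (\<kappa> * x) - of_nat l * of_real (\<kappa> * h)))))"
      by (intro sine_dd_cong) (simp add: htrunc_eq side v_def \<kappa>_def)
    also have "\<dots> = B y"
      unfolding B_def by (rule sine_dd_truncated_power) (use sep in simp)
    finally show ?thesis .
  qed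
  have "trig_dd h (Suc n) \<zeta> (htrunc h n x) = B \<zeta>"
  proof (cases "strict_mono_on {..Suc n} \<zeta>")
    case True
    then show ?thesis using distinct[OF True \<zeta>_span] by (simp add: trig_dd_def)
  next
    case not_strict: False
    let ?F = "nodes_at_left (Suc n) \<zeta>"
    have node: "((\<lambda>y. y i) \<longlongrightarrow> \<zeta> i) ?F" if "i \<le> Suc n" for i
      using filterlim_mono[OF filterlim_nodes_at_left[OF that] at_within_le_nhds order_refl] .
    have "(B \<longlongrightarrow> B \<zeta>) ?F"
      unfolding B_def
    proof (rule tendsto_spline_piece)
      show "((\<lambda>y. v y k) \<longlongrightarrow> v \<zeta> k) ?F" if "k \<in> {0..0 + Suc n}" for k
        unfolding v_def by (intro tendsto_of_real tendsto_mult tendsto_const node) (use that in simp)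
      show "(x < \<zeta> l) = (x < \<zeta> i)"
        if "i \<in> {0..0 + Suc n}" "k \<in> {0..0 + Suc n}" "sin (v \<zeta> k - v \<zeta> i) = 0" "i \<le> l" "l \<le> k"
        for i k l
        using knots_compatible[OF \<kappa> \<zeta>, of "Suc n" 0 i k l] that \<zeta>_span by (simp add: v_def)
    qed
    moreover have "\<forall>\<^sub>F y in ?F. B y = trig_dd_distinct h (Suc n) y (htrunc h n x)"
    proof -
      have "((\<lambda>y. \<kappa> * (y (Suc n) - y 0)) \<longlongrightarrow> \<kappa> * (\<zeta> (Suc n) - \<zeta> 0)) ?F"
        by (intro tendsto_mult tendsto_diff tendsto_const node) auto
      then have "\<forall>\<^sub>F y in ?F. \<kappa> * (y (Suc n) - y 0) < pi"
        by (rule order_tendstoD(2)) (rule \<zeta>_span)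
      moreover have "\<forall>\<^sub>F y in ?F. \<forall>i\<in>{..Suc n}. x < y i \<longleftrightarrow> x < \<zeta> i"
      proof (intro eventually_ball_finite ballI)
        fix i assume "i \<in> {..Suc n}"
        then have i: "i \<le> Suc n" by simp
        show "\<forall>\<^sub>F y in ?F. x < y i \<longleftrightarrow> x < \<zeta> i"
        proof (cases "x < \<zeta> i")
          case True
          then show ?thesis using order_tendstoD(1)[OF node[OF i]] by simp
        next
          case False
          have "\<forall>\<^sub>F y in ?F. y i \<in> {..<\<zeta> i}"
            using filterlim_nodes_at_left[OF i, of \<zeta>] unfolding filterlim_at
            by (auto elim: eventually_mono)
          then show ?thesis by eventually_elim (use False in auto)
        qed
      qed simp
      moreover note eventually_nodes_strict_mono[of "Suc n" \<zeta>]
      ultimately show ?thesis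
        by eventually_elim (simp add: distinct)
    qed
    ultimately have "((\<lambda>y. trig_dd_distinct h (Suc n) y (htrunc h n x)) \<longlongrightarrow> B \<zeta>) ?F"
      by (rule Lim_transform_eventually)
    moreover have "?F \<noteq> bot"
      by (rule nodes_at_left_nontrivial) (use \<zeta> in \<open>auto simp: mono_on_def mono_def\<close>)
    ultimately show ?thesis
      using not_strict by (simp add: trig_dd_def tendsto_Lim)
  qed
  moreover have "B \<zeta> = spline_piece (of_real (\<kappa> * h)) (\<lambda>i. of_real (\<kappa> * \<xi> i)) (\<lambda>i. x < \<xi> i)
      n j (of_real (\<kappa> * x))"
    using spline_piece_shift[of "of_real (\<kappa> * h)" "\<lambda>i. of_real (\<kappa> * \<xi> i)" j "\<lambda>i. x < \<xi> i" n 0]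
    by (simp add: B_def v_def \<zeta>_def)
  ultimately show ?thesis
    using False by (simp add: trig_bspline_def \<zeta>_def \<kappa>_def)
qed

theorem theorem5p6:
  fixes h x :: real and m j :: nat and \<xi> :: "nat \<Rightarrow> real"
  assumes "h \<noteq> 0" and "h > -1" and "m \<ge> 2" and "mono \<xi>"
    and "0 < \<xi> (j + m) - \<xi> j" and "\<xi> (j + m) - \<xi> j < 2 * pi * h / ln (1 + h)"
  shows "let D =
      \<i> * hcis h ((real m - 1) * h / 4)
        * ((hcis h (- ((real m - 1) * h / 2)) - 1)
           / (of_real h * hsin h ((\<xi> (j + m) - \<xi> j) / 2)))
        * (hcos h ((x - (real m - 3) * h / 2 - \<xi> j) / 2) * trig_bspline h \<xi> j (m - 1) x
           - hcos h ((\<xi> (j + m) - x + (real m - 3) * h / 2) / 2)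
             * trig_bspline h \<xi> (j + 1) (m - 1) x)
    in (x + h \<in> knot_cell \<xi> j m x \<longrightarrow> hdiff h (trig_bspline h \<xi> j m) x = D)
     \<and> (\<exists>P. P holomorphic_on UNIV
            \<and> (\<forall>t\<in>knot_cell \<xi> j m x. trig_bspline h \<xi> j m t = P (of_real t))
            \<and> hdiff h (\<lambda>t. P (of_real t)) x = D)"
proof -
  define \<kappa> where "\<kappa> = half_angle h"
  define v where "v = (\<lambda>i. complex_of_real (\<kappa> * \<xi> i))"
  define z where "z = complex_of_real (\<kappa> * x)"
  define \<eta> where "\<eta> = complex_of_real (\<kappa> * h)"
  define \<sigma> where "\<sigma> = (\<lambda>i. x < \<xi> i)"
  define P where "P = (\<lambda>w. spline_piece \<eta> v \<sigma> (m - 1) j (of_real \<kappa> * w))"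
  obtain n where m: "m = Suc (Suc n)"
    using \<open>m \<ge> 2\<close> by (metis Suc_le_D numeral_2_eq_2 Suc_le_mono)
  have \<kappa>: "\<kappa> > 0" unfolding \<kappa>_def by (rule half_angle_pos[OF assms(1,2)])
  have ln: "ln (1 + h) = 2 * h * \<kappa>"
    using assms(1) by (simp add: \<kappa>_def half_angle_def)
  have span: "\<kappa> * (\<xi> (j + m) - \<xi> j) < pi"
    using assms(1,6) \<kappa> unfolding ln by (simp add: field_simps)
  have sub: "\<kappa> * (\<xi> b - \<xi> a) < pi" if "j \<le> a" "b \<le> j + m" for a b
  proof -
    have "\<xi> j \<le> \<xi> a" "\<xi> b \<le> \<xi> (j + m)" using that assms(4) by (auto intro: monoD)
    then have "\<kappa> * (\<xi> b - \<xi> a) \<le> \<kappa> * (\<xi> (j + m) - \<xi> j)"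
      using \<kappa> by (intro mult_left_mono) auto
    then show ?thesis using span by simp
  qed
  define D where "D =
      \<i> * hcis h ((real m - 1) * h / 4)
        * ((hcis h (- ((real m - 1) * h / 2)) - 1)
           / (of_real h * hsin h ((\<xi> (j + m) - \<xi> j) / 2)))
        * (hcos h ((x - (real m - 3) * h / 2 - \<xi> j) / 2) * trig_bspline h \<xi> j (m - 1) x
           - hcos h ((\<xi> (j + m) - x + (real m - 3) * h / 2) / 2)
             * trig_bspline h \<xi> (j + 1) (m - 1) x)"
  have piece: "trig_bspline h \<xi> a (Suc k) t
      = spline_piece \<eta> v (\<lambda>i. t < \<xi> i) k a (of_real (\<kappa> * t))"
    if "j \<le> a" "a + Suc k \<le> j + m" for a k t
    unfolding \<eta>_def v_def \<kappa>_def
    by (rule trig_bspline_eq_spline_piece) (use assms that sub in \<open>auto simp: \<kappa>_def\<close>)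
  have hol: "P holomorphic_on UNIV"
  proof -
    have "spline_piece \<eta> v \<sigma> (m - 1) j \<circ> (\<lambda>w. of_real \<kappa> * w) holomorphic_on UNIV"
      by (rule holomorphic_on_compose_gen[OF _ spline_piece_holomorphic[of _ _ _ _ _ UNIV]])
         (auto intro!: holomorphic_intros)
    then show ?thesis by (simp add: P_def o_def)
  qed
  have cell: "trig_bspline h \<xi> j m t = P (of_real t)" if "t \<in> knot_cell \<xi> j m x" for t
    using that piece[of j "m - 1" t]
      spline_piece_cong[of j "m - 1" "\<lambda>i. t < \<xi> i" \<sigma> \<eta> v "of_real (\<kappa> * t)"]
    by (simp add: P_def m knot_cell_def \<sigma>_def)
  have diff: "hdiff h (\<lambda>t. P (of_real t)) x = D"
  proof -
    let ?S = "sin (v (j + m) - v j)"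
    let ?T0 = "trig_bspline h \<xi> j (m - 1) x" and ?T1 = "trig_bspline h \<xi> (j + 1) (m - 1) x"
    let ?c = "\<lambda>u. cos (u - (z - (of_nat n - 1) * \<eta> / 2))"
    let ?s = "2 * sin (of_nat (Suc n) * \<eta> / 2)"
    have "?S \<noteq> 0"
      unfolding v_def by (rule sin_scaled_diff_nonzero[OF \<kappa>]) (use assms(5) span in auto)
    have sin: "hsin h ((\<xi> (j + m) - \<xi> j) / 2) = ?S"
      unfolding hsin_half by (simp add: v_def right_diff_distrib flip: \<kappa>_def)
    \<comment> \<open>with \<open>\<theta> = (n + 1) \<eta> / 2\<close> this is \<open>\<i> e\<^sup>i\<^sup>\<theta> (e\<^sup>-\<^sup>2\<^sup>i\<^sup>\<theta> - 1) = 2 sin \<theta>\<close>\<close>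
    have "?s = \<i> * hcis h ((real m - 1) * h / 4) * (hcis h (- ((real m - 1) * h / 2)) - 1)"
    proof -
      let ?\<theta> = "of_nat (Suc n) * \<eta> / 2"
      have "hcis h ((real m - 1) * h / 4) = exp (\<i> * ?\<theta>)"
        "hcis h (- ((real m - 1) * h / 2)) = exp (- (\<i> * ?\<theta>)) * exp (- (\<i> * ?\<theta>))"
        unfolding exp_add[symmetric] hcis_eq \<kappa>_def[symmetric]
        by (rule arg_cong[where f = exp], simp add: m \<eta>_def field_simps)+
      moreover have "exp (\<i> * ?\<theta>) * exp (- (\<i> * ?\<theta>)) = 1"
        by (simp flip: exp_add)
      ultimately have "\<i> * hcis h ((real m - 1) * h / 4) * (hcis h (- ((real m - 1) * h / 2)) - 1)
          = \<i> * (exp (- (\<i> * ?\<theta>)) - exp (\<i> * ?\<theta>))"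
        by (simp add: right_diff_distrib mult.assoc[symmetric])
      also have "\<dots> = ?s"
        by (simp add: sin_exp_eq field_simps)
      finally show ?thesis ..
    qed
    moreover have "hcos h ((x - (real m - 3) * h / 2 - \<xi> j) / 2) = ?c (v j)"
      using cos_minus[of "v j - (z - (of_nat n - 1) * \<eta> / 2)"]
      unfolding hcos_half
      by (simp add: m v_def z_def \<eta>_def algebra_simps flip: \<kappa>_def)
    moreover have "hcos h ((\<xi> (j + m) - x + (real m - 3) * h / 2) / 2) = ?c (v (j + m))"
      unfolding hcos_half
      by (simp add: m v_def z_def \<eta>_def algebra_simps flip: \<kappa>_def)
    ultimately have D: "D = ?s / (of_real h * ?S) * (?c (v j) * ?T0 - ?c (v (j + m)) * ?T1)"
      unfolding D_def sin by simp
    have T: "?T0 = spline_piece \<eta> v \<sigma> n j z" "?T1 = spline_piece \<eta> v \<sigma> n (Suc j) z"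
      using piece[of j n x] piece[of "Suc j" n x] by (simp_all add: m z_def \<sigma>_def)
    have P: "P (of_real (x + h)) = spline_piece \<eta> v \<sigma> (Suc n) j (z + \<eta>)"
      "P (of_real x) = spline_piece \<eta> v \<sigma> (Suc n) j z"
      by (simp_all add: P_def m z_def \<eta>_def distrib_left)
    have "?S * (P (of_real (x + h)) - P (of_real x))
        = ?s * (?c (v j) * ?T0 - ?c (v (j + m)) * ?T1)"
      unfolding P T
      unfolding m v_def \<sigma>_def
      by (rule spline_piece_difference[OF \<kappa> assms(4)]) (use assms(5) span in \<open>simp_all add: m\<close>)
    then have "P (of_real (x + h)) - P (of_real x)
        = ?s * (?c (v j) * ?T0 - ?c (v (j + m)) * ?T1) / ?S"
      using \<open>?S \<noteq> 0\<close> by (simp add: eq_divide_eq mult.commute)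
    then show ?thesis
      unfolding D hdiff_def by simp
  qed
  have "x \<in> knot_cell \<xi> j m x" by (simp add: knot_cell_def)
  then have "x + h \<in> knot_cell \<xi> j m x \<longrightarrow> hdiff h (trig_bspline h \<xi> j m) x = D"
    using diff by (simp add: hdiff_def cell)
  then show ?thesis
    unfolding Let_def D_def[symmetric] using hol cell diff by blast
qed

end
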